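(* Let $\mathcal{K}$ and $\mathcal{K}'$ be sets of points in $\mathrm{PG}(5,3)$ such that $\#\mathcal{K}=\#\mathcal{K}'=12$ and such that $\#(\mathcal{H}\cap\mathcal{K})\in\{0,3,6\}$ and $\#(\mathcal{H}\cap\mathcal{K}')\in\{0,3,6\}$ for all hyperplanes $\mathcal{H}$ of $\mathrm{PG}(5,3)$. Choose five distinct points $P_0,\ldots,P_4$ in $\mathcal{K}$ and five distinct points $P_0',\ldots,P_4'$ in $\mathcal{K}'$. Then there is a unique collineation $\kappa$ of $\mathrm{PG}(5,3)$ with $\mathcal{K}^\kappa=\mathcal{K}'$ and $P_i^\kappa=P_i'$ for $i=0,\ldots,4$.
   Context: $\mathrm{PG}(5,3)$ is the $5$-dimensional projective space over $\mathrm{GF}(3)$, whose points are the one-dimensional subspaces and whose hyperplanes are the $5$-dimensional subspaces of a $6$-dimensional vector space over $\mathrm{GF}(3)$. A collineation is a bijection of the point set that maps lines onto lines. Images under maps are written as exponents. *)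

theory Defs
  imports "HOL-Analysis.Cartesian_Space" "HOL-Library.FuncSet" "HOL-Library.Numeral_Type"
begin

definition pg_points :: "('k::field ^ 'n) set set" where
  "pg_points = {P. vec.subspace P \<and> vec.dim P = 1}"

text \<open>Subspaces of projective space are represented by their sets of points;
  \<open>pg_flats d\<close> is indexed by the vector space dimension \<open>d\<close>,
  i.e. one more than the projective dimension.\<close>

definition pg_flats :: "nat \<Rightarrow> ('k::field ^ 'n) set set set" where
  "pg_flats d = {{P \<in> pg_points. P \<subseteq> U} | U. vec.subspace U \<and> vec.dim U = d}"

definition pg_lines :: "('k::field ^ 'n) set set set" where
  "pg_lines = pg_flats 2"

definition pg_hyperplanes :: "('k::field ^ 'n) set set set" where
  "pg_hyperplanes = pg_flats (CARD('n) - 1)"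

text \<open>A collineation is a map on points only. Since HOL functions are total, its value
  is pinned to \<open>undefined\<close> on arguments that are not points, so that equality of
  collineations is equality of maps on the point set.\<close>

definition pg_collineation :: "(('k::field ^ 'n) set \<Rightarrow> ('k ^ 'n) set) \<Rightarrow> bool" where
  "pg_collineation \<kappa> \<longleftrightarrow>
     \<kappa> \<in> extensional pg_points \<and> bij_betw \<kappa> pg_points pg_points \<and>
     (\<forall>L \<in> pg_lines. \<kappa> ` L \<in> pg_lines)"

end

theory Submission
  imports Defs
begin

text \<open>
  Choose a representing vector for each point of \<open>K\<close>. A hyperplane contains at most six points of \<open>K\<close>, and
  counting the zeros of \<open>f\<close>, \<open>g\<close>, \<open>f + g\<close> and \<open>f - g\<close> shows that two independent linear forms never
  share five zeros in \<open>K\<close>. So any five points of \<open>K\<close> are independent, and their span contains exactly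
  one further point of \<open>K\<close>, which after rescaling is the sum \<open>b\<^sub>0 + \<dots> + b\<^sub>4\<close>. The other six points lie
  off this hyperplane. On them the coordinate \<open>i < 5\<close>, normalized at the hyperplane, takes each value
  of GF(3) exactly twice, and every sum of two coordinates takes each value zero or three times.
  The coordinates thus induce a one-factorization of the complete graph on the six points; a
  signed pentagon describes it, and only one of the six possible origins yields the standard pentagon.
  Hence \<open>K\<close> with its five points has a normal form in a suitable basis, and the linear map between
  two such bases is the required collineation.

  For uniqueness, let a collineation fix the five points and preserve \<open>K\<close>. It fixes the sixth point
  of their hyperplane and commutes with the five perfect matchings of the remaining six points,
  which forces it to fix them all. Intersecting spans of fixed points then shows that it fixes
  every point.
\<close>

section \<open>Signed pentagons over GF(3)\<close>

text \<open>If \<open>1\<close> were equal to \<open>-1\<close>, an element \<open>y\<close> outside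
  {0, 1} would yield \<open>y + 1\<close> as a fourth element. So 0, 1 and -1 are distinct and
  exhaust the field, and \<open>1 + 1\<close>, being neither 0 nor 1, must be -1.\<close>

lemma gf3_cases:
  assumes "CARD('k::field) = 3"
  shows "(x::'k) = 0 \<or> x = 1 \<or> x = -1" and "(1::'k) + 1 = -1" and "(1::'k) \<noteq> -1"
proof -
  have fin: "finite (UNIV :: 'k set)" using assms by (intro card_ge_0_finite) simp
  have ne: "(1::'k) \<noteq> -1"
  proof
    assume eq: "(1::'k) = -1"
    have "card {0, 1::'k} < CARD('k)" using assms by simp
    then obtain y :: 'k where y: "y \<notin> {0, 1}"
      by (metis UNIV_eq_I less_irrefl)
    have "y + 1 \<noteq> 0" using y eq by (metis add_eq_0_iff2 insertCI)
    then have "card {0, 1, y, y + 1} = 4" using y by auto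
    moreover have "card {0, 1, y, y + 1} \<le> CARD('k)" by (intro card_mono fin) simp
    ultimately show False using assms by simp
  qed
  have "card {0, 1, -1 :: 'k} = CARD('k)" using ne assms by simp
  then have U: "{0, 1, -1 :: 'k} = UNIV" by (intro card_subset_eq fin) auto
  show "x = 0 \<or> x = 1 \<or> x = -1" using U by blast
  have "(1::'k) + 1 \<in> {0, 1, -1}" using U by blast
  moreover have "(1::'k) + 1 \<noteq> 0" using ne by (simp only: eq_neg_iff_add_eq_0 not_False_eq_True)
  moreover have "(1::'k) + 1 \<noteq> 1" by (simp only: add_cancel_left_right) simp
  ultimately show "(1::'k) + 1 = -1" by blast
  show "(1::'k) \<noteq> -1" by (fact ne)
qed

lemma gf3_numeral:
  assumes "CARD('k::field) = 3"
  shows "(2::'k) = -1" and "(3::'k) = 0"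
proof -
  show two: "(2::'k) = -1" using gf3_cases(2)[OF assms] by simp
  have "(3::'k) = 2 + 1" by simp
  also have "\<dots> = 0" by (simp only: two add.left_inverse)
  finally show "(3::'k) = 0" .
qed

section \<open>The standard pentagon and its matchings\<close>

text \<open>For indices below 5 the entry is the Legendre symbol of \<open>i - k\<close> modulo 5,
  the circulant block in the usual generator matrix of the extended ternary Golay code. Column 5 is
  a zero column for the origin.\<close>

definition pentagon :: "nat \<Rightarrow> nat \<Rightarrow> 'k::field" where
  "pentagon i k = (if k = 5 \<or> i = k then 0
     else if k = (i + 1) mod 5 \<or> i = (k + 1) mod 5 then 1 else -1)"

text \<open>\<open>partner i\<close> is the fixed-point-free involution of the six columns that matches the columns with
  equal entries in row \<open>i\<close> of \<open>pentagon\<close>.\<close>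

definition partner :: "nat \<Rightarrow> nat \<Rightarrow> nat" where
  "partner i k = [[5, 4, 3, 2, 1, 0], [2, 5, 0, 4, 3, 1], [4, 3, 5, 1, 0, 2],
     [1, 0, 4, 5, 2, 3], [3, 2, 1, 0, 5, 4]] ! i ! k"

lemma nat_less_5: "(i::nat) < 5 \<longleftrightarrow> i \<in> {0, 1, 2, 3, 4}"
  by auto

lemma nat_less_6: "(i::nat) < 6 \<longleftrightarrow> i \<in> {0, 1, 2, 3, 4, 5}"
  by auto

lemma pentagon_table:
  "pentagon 0 0 = 0" "pentagon 0 1 = 1" "pentagon 0 2 = -1" "pentagon 0 3 = -1" "pentagon 0 4 = 1" "pentagon 0 5 = 0"
  "pentagon 1 0 = 1" "pentagon 1 1 = 0" "pentagon 1 2 = 1" "pentagon 1 3 = -1" "pentagon 1 4 = -1" "pentagon 1 5 = 0"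
  "pentagon 2 0 = -1" "pentagon 2 1 = 1" "pentagon 2 2 = 0" "pentagon 2 3 = 1" "pentagon 2 4 = -1" "pentagon 2 5 = 0"
  "pentagon 3 0 = -1" "pentagon 3 1 = -1" "pentagon 3 2 = 1" "pentagon 3 3 = 0" "pentagon 3 4 = 1" "pentagon 3 5 = 0"
  "pentagon 4 0 = 1" "pentagon 4 1 = -1" "pentagon 4 2 = -1" "pentagon 4 3 = 1" "pentagon 4 4 = 0" "pentagon 4 5 = 0"
  "pentagon (Suc 0) 0 = 1" "pentagon (Suc 0) 2 = 1" "pentagon (Suc 0) 3 = -1" "pentagon (Suc 0) 4 = -1" "pentagon (Suc 0) 5 = 0"
  "pentagon 0 (Suc 0) = 1" "pentagon (Suc 0) (Suc 0) = 0" "pentagon 2 (Suc 0) = 1" "pentagon 3 (Suc 0) = -1" "pentagon 4 (Suc 0) = -1"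
  by (simp_all add: pentagon_def)

lemma partner_less: "i < 5 \<Longrightarrow> k < 6 \<Longrightarrow> partner i k < 6"
  unfolding nat_less_5 nat_less_6 by (auto simp: partner_def)

lemma pentagon_partner:
  "i < 5 \<Longrightarrow> k < 6 \<Longrightarrow> pentagon i (partner i k) = (pentagon i k :: 'k::field)"
  unfolding nat_less_5 nat_less_6 by (auto simp: partner_def pentagon_table)

lemma partner_neq: "i < 5 \<Longrightarrow> k < 6 \<Longrightarrow> partner i k \<noteq> k"
  unfolding nat_less_5 nat_less_6 by (auto simp: partner_def)

text \<open>Each row contains 0, 1 and -1 exactly twice among the six columns, so a column shares
  its entry with just one other.\<close>

lemma partner_unique:
  assumes "(1::'k::field) \<noteq> -1"
  assumes "i < 5" "k < 6" "l < 6" "l \<noteq> k" "pentagon i l = (pentagon i k :: 'k)"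
  shows "l = partner i k"
proof -
  note ne = assms(1) assms(1)[symmetric]
  have "\<forall>i\<in>{0,1,2,3,4}. \<forall>k\<in>{0,1,2,3,4,5}. \<forall>l\<in>{0,1,2,3,4,5}.
      l \<noteq> k \<longrightarrow> pentagon i l = (pentagon i k :: 'k) \<longrightarrow> l = partner i k"
    by (simp add: partner_def pentagon_table ne)
  then show ?thesis using assms(2-) unfolding nat_less_5 nat_less_6 by blast
qed

text \<open>Since \<open>partner i 5 = i\<close>, a map commuting with all five matchings is
  determined by its value at 5. It remains to show that this value is 5.\<close>

lemma centralizer_partners_trivial:
  assumes tau: "\<And>k. k < 6 \<Longrightarrow> \<tau> k < 6"
    and comm: "\<And>i k. i < 5 \<Longrightarrow> k < 6 \<Longrightarrow> \<tau> (partner i k) = partner i (\<tau> k)"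
    and k: "k < 6"
  shows "\<tau> k = k"
proof -
  have p5: "partner i 5 = i" if "i < 5" for i
    using that unfolding nat_less_5 by (auto simp: partner_def)
  have i: "\<tau> i = partner i (\<tau> 5)" if "i < 5" for i
    using comm[OF that, of 5] p5[OF that] by simp
  \<comment> \<open>These relations come from \<open>partner 0 1 = 4\<close> and
    \<open>partner 1 0 = 2\<close>. The first leaves only 0 and 5 as values of
    \<open>\<tau> 5\<close>; the second rules out 0.\<close>
  have A: "partner 0 (partner 1 (\<tau> 5)) = partner 4 (\<tau> 5)"
    using comm[of 0 1] i[of 1] i[of 4] by (simp add: partner_def)
  have B: "partner 1 (partner 0 (\<tau> 5)) = partner 2 (\<tau> 5)"
    using comm[of 1 0] i[of 0] i[of 2] by (simp add: partner_def)
  have "\<tau> 5 \<in> {0, 1, 2, 3, 4, 5}" using tau[of 5] unfolding nat_less_6 by simp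
  then have t5: "\<tau> 5 = 5" using A B
    by (elim insertE emptyE; simp add: partner_def)
  show ?thesis
  proof (cases "k = 5")
    case False
    then show ?thesis using i[of k] p5[of k] k t5 by simp
  qed (use t5 in simp)
qed

section \<open>Normalizing a signed pentagon\<close>

text \<open>With p plus signs the sum is 2p - 4, which for p between 0 and 4 is divisible by 3 only
  when p = 2. The six cases are the choices of the two plus signs.\<close>

lemma balanced_signs:
  fixes w x y z :: "'k::field"
  assumes k3: "CARD('k) = 3" and sum: "w + x + y + z = 0"
    and "w = 1 \<or> w = -1" "x = 1 \<or> x = -1" "y = 1 \<or> y = -1" "z = 1 \<or> z = -1"
  shows "w = 1 \<and> x = 1 \<and> y \<noteq> 1 \<and> z \<noteq> 1 \<or> w = 1 \<and> x \<noteq> 1 \<and> y = 1 \<and> z \<noteq> 1 \<or>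
    w = 1 \<and> x \<noteq> 1 \<and> y \<noteq> 1 \<and> z = 1 \<or> w \<noteq> 1 \<and> x = 1 \<and> y = 1 \<and> z \<noteq> 1 \<or>
    w \<noteq> 1 \<and> x = 1 \<and> y \<noteq> 1 \<and> z = 1 \<or> w \<noteq> 1 \<and> x \<noteq> 1 \<and> y = 1 \<and> z = 1"
proof -
  have "(4::'k) = 3 + 1" by simp
  then have four: "(4::'k) = 1" by (simp only: gf3_numeral[OF k3] add_0)
  note ne = gf3_cases(3)[OF k3]
  show ?thesis using assms(3-) sum
    by (elim disjE; simp add: four gf3_numeral[OF k3] ne ne[symmetric])
qed

text \<open>For a signed pentagon \<open>a\<close>, some choice of the origin column \<open>\<pi> 5\<close> produces the standard one up to
  sign. The six permutations in the proof belong to the six pentagons through the edge \<open>{0, 1}\<close> and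
  were found by search.\<close>

lemma signed_pentagon_normal_form:
  fixes a :: "nat \<Rightarrow> nat \<Rightarrow> 'k::field"
  assumes k3: "CARD('k) = 3"
    and diag: "\<And>i. i < 5 \<Longrightarrow> a i i = 0"
    and last: "\<And>i. i < 5 \<Longrightarrow> a i 5 = 0"
    and pm: "\<And>i k. i < 5 \<Longrightarrow> k < 5 \<Longrightarrow> i \<noteq> k \<Longrightarrow> a i k \<noteq> 0"
    and sym: "\<And>i k. i < 5 \<Longrightarrow> k < 5 \<Longrightarrow> a i k = a k i"
    and row: "\<And>i. i < 5 \<Longrightarrow> (\<Sum>k<5. a i k) = 0"
  shows "\<exists>\<pi> \<epsilon>. bij_betw \<pi> {..<6} {..<6} \<and> \<epsilon> * \<epsilon> = 1 \<and>
    (\<forall>i<5. \<forall>k<6. a i (\<pi> k) - a i (\<pi> 5) = \<epsilon> * pentagon i k)"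
proof -
  note [simp del] = One_nat_def
  note two = gf3_numeral[OF k3] and ne = gf3_cases(3)[OF k3]
  \<comment> \<open>Multiplying by this sign makes the edge between 0 and 1 positive and halves the
    number of cases.\<close>
  define e where "e = a 0 1"
  have pm1: "x = 1 \<or> x = -1" if "x \<noteq> 0" for x :: 'k using gf3_cases(1)[OF k3] that by blast
  have ee: "e * e = 1" using pm1[of e] pm[of 0 1] by (auto simp: e_def)
  define A where "A i k = e * a i k" for i k
  have a: "a i k = e * A i k" for i k unfolding A_def using ee by (simp add: mult.assoc[symmetric])
  have Apm: "A i k = 1 \<or> A i k = -1" if "i < 5" "k < 5" "i \<noteq> k" for i k
    by (rule pm1) (use pm[OF that] ee in \<open>auto simp: A_def\<close>)
  have Asym: "A i k = A k i" if "i < 5" "k < 5" for i k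
    using sym[OF that] by (simp add: A_def)
  have Arow: "A i 0 + A i 1 + A i 2 + A i 3 + A i 4 = 0" if "i < 5" for i
  proof -
    have "{..<5::nat} = {0, 1, 2, 3, 4}" by auto
    then have "a i 0 + a i 1 + a i 2 + a i 3 + a i 4 = 0" using row[OF that]
      by (simp add: add.assoc)
    then show ?thesis unfolding A_def by (simp only: distrib_left[symmetric] mult_zero_right)
  qed
  have A01: "A 0 1 = 1" using ee by (simp add: A_def e_def)
  have Ad: "A 0 0 = 0" "A 1 1 = 0" "A 2 2 = 0" "A 3 3 = 0" "A 4 4 = 0"
    using diag by (simp_all add: A_def)
  have Al: "A 0 5 = 0" "A 1 5 = 0" "A 2 5 = 0" "A 3 5 = 0" "A 4 5 = 0"
    using last by (simp_all add: A_def)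
  have As: "A 1 0 = 1" "A 2 0 = A 0 2" "A 3 0 = A 0 3" "A 4 0 = A 0 4"
     "A 2 1 = A 1 2" "A 3 1 = A 1 3" "A 4 1 = A 1 4"
     "A 3 2 = A 2 3" "A 4 2 = A 2 4" "A 4 3 = A 3 4"
    using A01 Asym[of 1 0] Asym[of 2 0] Asym[of 3 0] Asym[of 4 0] Asym[of 2 1] Asym[of 3 1]
      Asym[of 4 1] Asym[of 3 2] Asym[of 4 2] Asym[of 4 3] by simp_all
  \<comment> \<open>A case is settled by listing \<open>\<pi>\<close> as \<open>xs\<close> and
    giving a sign \<open>s\<close> relative to \<open>A\<close>; the sign for \<open>a\<close> is
    then \<open>e * s\<close>.\<close>
  have goal: ?thesis
    if set: "set xs = {0, 1, 2, 3, 4, 5}" and len: "length xs = 6" and ss: "s * s = 1"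
      and eq: "\<forall>i\<in>{0,1,2,3,4}. \<forall>k\<in>{0,1,2,3,4,5}. A i (xs ! k) - A i (xs ! 5) = s * pentagon i k"
    for xs :: "nat list" and s :: 'k
  proof (intro exI conjI allI impI)
    have "(\<lambda>k. xs ! k) ` {..<6} = set xs" using len by (auto simp: set_conv_nth)
    also have "\<dots> = {..<6}" using set by auto
    finally show "bij_betw (\<lambda>k. xs ! k) {..<6} {..<6}"
      by (simp add: bij_betw_def eq_card_imp_inj_on)
    show "(e * s) * (e * s) = 1" using ee ss by (metis mult.assoc mult.commute mult_1_right)
    show "a i (xs ! k) - a i (xs ! 5) = e * s * pentagon i k" if "i < 5" "k < 6" for i k
    proof -
      have "A i (xs ! k) - A i (xs ! 5) = s * pentagon i k"
        using eq that unfolding nat_less_5 nat_less_6 by blast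
      then show ?thesis unfolding a by (simp only: right_diff_distrib[symmetric] mult.assoc)
    qed
  qed
  define B where "B i k \<longleftrightarrow> A i k = 1" for i k
  have AB: "A i k = (if B i k then 1 else -1)" if "i < 5" "k < 5" "i \<noteq> k" for i k
    using Apm[OF that] ne by (auto simp: B_def)
  have sums: "A 0 1 + A 0 2 + A 0 3 + A 0 4 = 0"
    "A 0 1 + A 1 2 + A 1 3 + A 1 4 = 0"
    "A 0 2 + A 1 2 + A 2 3 + A 2 4 = 0"
    "A 0 3 + A 1 3 + A 2 3 + A 3 4 = 0"
    "A 0 4 + A 1 4 + A 2 4 + A 3 4 = 0"
    using Arow[of 0] Arow[of 1] Arow[of 2] Arow[of 3] Arow[of 4] by (simp_all add: Ad As A01)
  have B01: "B 0 1" using A01 by (simp add: B_def)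
  note rows = sums[THEN balanced_signs[OF k3, OF _ Apm Apm Apm Apm], folded B_def, simplified, simplified B01]
  \<comment> \<open>By \<open>balanced_signs\<close> every vertex lies on two positive edges, so the
    positive edges form a 5-cycle. Six of the twelve 5-cycles on five vertices contain the edge {0,
    1}; the tuple records the other nine edges.\<close>
  have vals: "(B 0 2, B 0 3, B 0 4, B 1 2, B 1 3, B 1 4, B 2 3, B 2 4, B 3 4) \<in>
      {(True,False,False,False,True,False,False,True,True), (True,False,False,False,False,True,True,False,True),
       (False,True,False,True,False,False,False,True,True), (False,True,False,False,False,True,True,True,False),
       (False,False,True,True,False,False,True,False,True), (False,False,True,False,True,False,True,True,False)}"
    using rows(1) rows(2) by (elim disjE conjE; use rows(3-5) in \<open>simp, blast?\<close>)
  have AA: "A 0 2 = (if B 0 2 then 1 else -1)" "A 0 3 = (if B 0 3 then 1 else -1)"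
    "A 0 4 = (if B 0 4 then 1 else -1)" "A 1 2 = (if B 1 2 then 1 else -1)"
    "A 1 3 = (if B 1 3 then 1 else -1)" "A 1 4 = (if B 1 4 then 1 else -1)"
    "A 2 3 = (if B 2 3 then 1 else -1)" "A 2 4 = (if B 2 4 then 1 else -1)"
    "A 3 4 = (if B 3 4 then 1 else -1)"
    by (rule AB; simp)+
  note tab = Ad Al As A01 pentagon_table two
  from vals show ?thesis
  proof (elim insertE emptyE)
    assume "(B 0 2, B 0 3, B 0 4, B 1 2, B 1 3, B 1 4, B 2 3, B 2 4, B 3 4) =
      (True,False,False,False,True,False,False,True,True)"
    then have v: "A 0 2 = 1" "A 0 3 = -1" "A 0 4 = -1" "A 1 2 = -1" "A 1 3 = 1"
      "A 1 4 = -1" "A 2 3 = -1" "A 2 4 = 1" "A 3 4 = 1"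
      using AA by simp_all
    show ?thesis
      by (rule goal[of "[1, 4, 5, 0, 3, 2]" "1"]) (auto simp: tab v)
  next
    assume "(B 0 2, B 0 3, B 0 4, B 1 2, B 1 3, B 1 4, B 2 3, B 2 4, B 3 4) =
      (True,False,False,False,False,True,True,False,True)"
    then have v: "A 0 2 = 1" "A 0 3 = -1" "A 0 4 = -1" "A 1 2 = -1" "A 1 3 = -1"
      "A 1 4 = 1" "A 2 3 = 1" "A 2 4 = -1" "A 3 4 = 1"
      using AA by simp_all
    show ?thesis
      by (rule goal[of "[4, 2, 0, 5, 1, 3]" "-1"]) (auto simp: tab v)
  next
    assume "(B 0 2, B 0 3, B 0 4, B 1 2, B 1 3, B 1 4, B 2 3, B 2 4, B 3 4) =
      (False,True,False,True,False,False,False,True,True)"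
    then have v: "A 0 2 = -1" "A 0 3 = 1" "A 0 4 = -1" "A 1 2 = 1" "A 1 3 = -1"
      "A 1 4 = -1" "A 2 3 = -1" "A 2 4 = 1" "A 3 4 = 1"
      using AA by simp_all
    show ?thesis
      by (rule goal[of "[3, 5, 4, 2, 0, 1]" "-1"]) (auto simp: tab v)
  next
    assume "(B 0 2, B 0 3, B 0 4, B 1 2, B 1 3, B 1 4, B 2 3, B 2 4, B 3 4) =
      (False,True,False,False,False,True,True,True,False)"
    then have v: "A 0 2 = -1" "A 0 3 = 1" "A 0 4 = -1" "A 1 2 = -1" "A 1 3 = -1"
      "A 1 4 = 1" "A 2 3 = 1" "A 2 4 = 1" "A 3 4 = -1"
      using AA by simp_all
    show ?thesis
      by (rule goal[of "[2, 0, 3, 1, 5, 4]" "1"]) (auto simp: tab v)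
  next
    assume "(B 0 2, B 0 3, B 0 4, B 1 2, B 1 3, B 1 4, B 2 3, B 2 4, B 3 4) =
      (False,False,True,True,False,False,True,False,True)"
    then have v: "A 0 2 = -1" "A 0 3 = -1" "A 0 4 = 1" "A 1 2 = 1" "A 1 3 = -1"
      "A 1 4 = -1" "A 2 3 = 1" "A 2 4 = -1" "A 3 4 = 1"
      using AA by simp_all
    \<comment> \<open>Here the positive edges already form the standard pentagon, so the identity
      permutation suffices.\<close>
    show ?thesis
      by (rule goal[of "[0, 1, 2, 3, 4, 5]" "1"]) (auto simp: tab v)
  next
    assume "(B 0 2, B 0 3, B 0 4, B 1 2, B 1 3, B 1 4, B 2 3, B 2 4, B 3 4) =
      (False,False,True,False,True,False,True,True,False)"
    then have v: "A 0 2 = -1" "A 0 3 = -1" "A 0 4 = 1" "A 1 2 = -1" "A 1 3 = 1"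
      "A 1 4 = -1" "A 2 3 = 1" "A 2 4 = 1" "A 3 4 = -1"
      using AA by simp_all
    show ?thesis
      by (rule goal[of "[5, 3, 1, 4, 2, 0]" "-1"]) (auto simp: tab v)
  qed
qed

section \<open>Six points with balanced coordinates\<close>

text \<open>Shifted to vanish at a point \<open>p\<close>, each \<open>g i\<close> has exactly one
  further zero \<open>z i\<close>. The condition on sums makes the \<open>z i\<close> distinct and
  the matrix of the values at them symmetric; balance makes its rows sum to zero. This is a signed
  pentagon.\<close>

lemma six_points_normal_form:
  fixes g :: "nat \<Rightarrow> 'w \<Rightarrow> 'k::field"
  assumes k3: "CARD('k) = 3" and W: "card W = 6"
    and bal: "\<And>i c. i < 5 \<Longrightarrow> card {w \<in> W. g i w = c} = 2"
    and sum: "\<And>i j c. i < 5 \<Longrightarrow> j < 5 \<Longrightarrow> i \<noteq> j \<Longrightarrow> card {w \<in> W. g i w + g j w = c} \<in> {0, 3}"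
  obtains \<omega> \<epsilon> where "bij_betw \<omega> {..<6} W" and "\<epsilon> * \<epsilon> = 1"
    and "\<forall>i<5. \<forall>k<6. g i (\<omega> k) - g i (\<omega> 5) = \<epsilon> * pentagon i k"
proof -
  note c3 = gf3_cases(1)[OF k3] and two = gf3_cases(2)[OF k3] and ne = gf3_cases(3)[OF k3]
  have fin: "finite W" using W by (intro card_ge_0_finite) simp
  \<comment> \<open>The origin is arbitrary here; the permutation \<open>\<pi>\<close> obtained at
    the end moves it to the right place.\<close>
  obtain p where p: "p \<in> W" using W by fastforce
  define h where "h i w = g i w - g i p" for i w
  have balh: "card {w \<in> W. h i w = c} = 2" if "i < 5" for i c
    using bal[OF that, of "c + g i p"] by (simp add: h_def diff_eq_eq)
  have sumh: "card {w \<in> W. h i w + h j w = c} \<in> {0, 3}" if "i < 5" "j < 5" "i \<noteq> j" for i j c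
  proof -
    have "{w \<in> W. h i w + h j w = c} = {w \<in> W. g i w + g j w = c + g i p + g j p}"
      by (auto simp: h_def algebra_simps)
    then show ?thesis using sum[OF that] by simp
  qed
  have hp: "h i p = 0" for i by (simp add: h_def)
  have "\<exists>z. z \<noteq> p \<and> {w \<in> W. h i w = 0} = {p, z}" if "i < 5" for i
  proof -
    obtain x y where xy: "{w \<in> W. h i w = 0} = {x, y}" "x \<noteq> y"
      using balh[OF \<open>i < 5\<close>, of 0] by (auto simp: card_2_iff)
    moreover have "p \<in> {w \<in> W. h i w = 0}" using p hp by simp
    ultimately show ?thesis by (metis doubleton_eq_iff insertE singletonD)
  qed
  then obtain z where z: "\<And>i. i < 5 \<Longrightarrow> z i \<noteq> p \<and> {w \<in> W. h i w = 0} = {p, z i}" by metis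
  have zW: "z i \<in> W" and zp: "z i \<noteq> p" and hz: "h i (z i) = 0" if "i < 5" for i
    using z[OF that] by auto
  have h0: "w = p \<or> w = z i" if "i < 5" "w \<in> W" "h i w = 0" for i w
    using z[OF that(1)] that by blast
  \<comment> \<open>The point \<open>p\<close> makes level 0 of the sum nonempty, so it has three
    points. The two nonzero levels share the other three points and have size 0 or 3, so one of them
    takes all.\<close>
  have level: "card {w \<in> W. h i w + h j w \<noteq> 0} = 3 \<and>
      (\<exists>t. t \<noteq> 0 \<and> (\<forall>w\<in>W. h i w + h j w \<noteq> 0 \<longrightarrow> h i w + h j w = t))"
    if ij: "i < 5" "j < 5" "i \<noteq> j" for i j
  proof -
    let ?S = "\<lambda>c. {w \<in> W. h i w + h j w = c}"
    have "p \<in> ?S 0" using p hp by simp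
    then have "card (?S 0) \<noteq> 0" using fin by (auto simp: card_eq_0_iff)
    then have S0: "card (?S 0) = 3" using sumh[OF ij, of 0] by simp
    have "{w \<in> W. h i w + h j w \<noteq> 0} = W - ?S 0" by auto
    then have c: "card {w \<in> W. h i w + h j w \<noteq> 0} = 3"
      using S0 W fin by (simp add: card_Diff_subset)
    show ?thesis
    proof (cases "?S 1 = {}")
      case True
      then have "\<forall>w\<in>W. h i w + h j w \<noteq> 0 \<longrightarrow> h i w + h j w = -1" using c3 by blast
      then show ?thesis using c by (intro conjI exI[of _ "-1"]) auto
    next
      case False
      then have "card (?S 1) \<noteq> 0" using fin by auto
      then have S1: "card (?S 1) = 3" using sumh[OF ij, of 1] by simp
      have "?S 1 = {w \<in> W. h i w + h j w \<noteq> 0}"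
        by (rule card_subset_eq) (use fin c S1 in auto)
      then show ?thesis using c by (intro conjI exI[of _ 1]) auto
    qed
  qed
  have zinj: "z i \<noteq> z j" if ij: "i < 5" "j < 5" "i \<noteq> j" for i j
  proof
    assume eq: "z i = z j"
    obtain t where t: "t \<noteq> 0" "\<And>w. w \<in> W \<Longrightarrow> h i w + h j w \<noteq> 0 \<Longrightarrow> h i w + h j w = t"
      using level[OF ij] by blast
    \<comment> \<open>With a common second zero, both coordinates are nonzero wherever their sum is.
      Two signs with nonzero sum are equal, and \<open>x = -(x + x)\<close> over GF(3). So
      \<open>h i\<close> would take the value \<open>-t\<close> three times instead of
      twice.\<close>
    have "{w \<in> W. h i w + h j w \<noteq> 0} \<subseteq> {w \<in> W. h i w = -t}"
    proof safe
      fix w assume w: "w \<in> W" "h i w + h j w \<noteq> 0"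
      then have "h i w \<noteq> 0" "h j w \<noteq> 0"
        using h0[OF ij(1) w(1)] h0[OF ij(2) w(1)] hz[OF ij(1)] hz[OF ij(2)] hp eq by auto
      moreover have "x = -(x + y)" if "x \<noteq> 0" "y \<noteq> 0" "x + y \<noteq> 0" for x y :: 'k
      proof -
        have "x = 1 \<and> y = 1 \<or> x = -1 \<and> y = -1" using c3[of x] c3[of y] that by auto
        then show ?thesis using two by (metis add.inverse_inverse minus_add_distrib)
      qed
      ultimately have "h i w = -(h i w + h j w)" using w(2) by blast
      then show "h i w = -t" using t(2)[OF w] by simp
    qed
    then have "card {w \<in> W. h i w + h j w \<noteq> 0} \<le> card {w \<in> W. h i w = -t}"
      by (intro card_mono) (use fin in auto)
    then show False using level[OF ij] balh[OF ij(1), of "-t"] by simp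
  qed
  have hzne: "h i (z j) \<noteq> 0" if "i < 5" "j < 5" "i \<noteq> j" for i j
    using h0[OF that(1) zW[OF that(2)]] zp[OF that(2)] zinj[OF that] by auto
  \<comment> \<open>At \<open>z i\<close> and at \<open>z j\<close> one summand of
    \<open>h i + h j\<close> vanishes and the other does not, so both sides are the single nonzero
    value of the sum.\<close>
  have sym: "h i (z j) = h j (z i)" if ij: "i < 5" "j < 5" for i j
  proof (cases "i = j")
    case False
    obtain t where t: "\<And>w. w \<in> W \<Longrightarrow> h i w + h j w \<noteq> 0 \<Longrightarrow> h i w + h j w = t"
      using level[OF ij False] by blast
    show ?thesis using t[OF zW[OF ij(1)]] t[OF zW[OF ij(2)]]
        hzne[OF ij False] hzne[OF ij(2,1)] False hz[OF ij(1)] hz[OF ij(2)] by auto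
  qed simp
  define \<omega> where "\<omega> k = (if k = (5::nat) then p else z k)" for k
  have inj: "inj_on \<omega> {..<6}"
  proof (rule inj_onI)
    fix i j :: nat assume ij: "i \<in> {..<6}" "j \<in> {..<6}" "\<omega> i = \<omega> j"
    then have "i = 5 \<or> i < 5" "j = 5 \<or> j < 5" by auto
    then show "i = j" using ij(3) zp zinj[of i j] zp[of j] by (auto simp: \<omega>_def split: if_splits)
  qed
  have "\<omega> ` {..<6} = W"
  proof (rule card_subset_eq[OF fin])
    show "\<omega> ` {..<6} \<subseteq> W"
    proof safe
      fix k :: nat assume "k < 6"
      then have "k = 5 \<or> k < 5" by auto
      then show "\<omega> k \<in> W" using p zW by (auto simp: \<omega>_def)
    qed
    show "card (\<omega> ` {..<6}) = card W" using card_image[OF inj] W by simp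
  qed
  with inj have bij: "bij_betw \<omega> {..<6} W" by (simp add: bij_betw_def)
  have row: "(\<Sum>k<5. h i (\<omega> k)) = 0" if i: "i < 5" for i
  proof -
    have "(\<Sum>w\<in>W. h i w) = (\<Sum>w\<in>W. of_bool (h i w = 1) - of_bool (h i w = -1))"
    proof (rule sum.cong[OF refl])
      fix w show "h i w = of_bool (h i w = 1) - of_bool (h i w = -1)"
        using c3[of "h i w"] ne by auto
    qed
    also have "\<dots> = of_nat (card {w \<in> W. h i w = 1}) - of_nat (card {w \<in> W. h i w = -1})"
      using fin by (simp add: sum_subtractf Collect_conj_eq Int_commute)
    also have "\<dots> = 0" using balh[OF i] by simp
    finally have "(\<Sum>k<6. h i (\<omega> k)) = 0"
      using sum.reindex_bij_betw[OF bij, of "h i"] by simp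
    moreover have "{..<6} = insert 5 {..<5::nat}" by auto
    ultimately show ?thesis by (simp add: \<omega>_def hp)
  qed
  have "\<exists>\<pi> \<epsilon>. bij_betw \<pi> {..<6} {..<6} \<and> \<epsilon> * \<epsilon> = 1 \<and>
    (\<forall>i<5. \<forall>k<6. h i (\<omega> (\<pi> k)) - h i (\<omega> (\<pi> 5)) = \<epsilon> * pentagon i k)"
  proof (rule signed_pentagon_normal_form[OF k3])
    have z\<omega>: "\<omega> k = z k" if "k < 5" for k using that by (simp add: \<omega>_def)
    show "h i (\<omega> i) = 0" if "i < 5" for i using hz[OF that] z\<omega>[OF that] by simp
    show "h i (\<omega> 5) = 0" for i by (simp add: \<omega>_def hp)
    show "h i (\<omega> k) \<noteq> 0" if "i < 5" "k < 5" "i \<noteq> k" for i k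
      using hzne[OF that] z\<omega>[OF that(2)] by simp
    show "h i (\<omega> k) = h k (\<omega> i)" if "i < 5" "k < 5" for i k
      using sym[OF that] z\<omega>[OF that(1)] z\<omega>[OF that(2)] by simp
    show "(\<Sum>k<5. h i (\<omega> k)) = 0" if "i < 5" for i using row[OF that] .
  qed
  then obtain \<pi> \<epsilon> where pi: "bij_betw \<pi> {..<6} {..<6}" "\<epsilon> * \<epsilon> = 1"
    "\<And>i k. i < 5 \<Longrightarrow> k < 6 \<Longrightarrow> h i (\<omega> (\<pi> k)) - h i (\<omega> (\<pi> 5)) = \<epsilon> * pentagon i k" by blast
  show thesis
  proof (rule that)
    show "bij_betw (\<omega> \<circ> \<pi>) {..<6} W" using pi(1) bij by (rule bij_betw_trans)
    show "\<epsilon> * \<epsilon> = 1" by fact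
    show "\<forall>i<5. \<forall>k<6. g i ((\<omega> \<circ> \<pi>) k) - g i ((\<omega> \<circ> \<pi>) 5) = \<epsilon> * pentagon i k"
      using pi(3) by (simp add: h_def)
  qed
qed

section \<open>Linear forms and bases\<close>

abbreviation linear_form :: "('k::field ^ 'n \<Rightarrow> 'k) \<Rightarrow> bool" where
  "linear_form \<equiv> Vector_Spaces.linear (*s) (*)"

lemma linear_form_iff:
  "linear_form f \<longleftrightarrow> (\<forall>x y. f (x + y) = f x + f y) \<and> (\<forall>c x. f (c *s x) = c * f x)"
  by (simp add: Vector_Spaces.linear_iff vec.vector_space_axioms vector_space_over_itself.vector_space_axioms)

lemma linear_form_sum:
  assumes "linear_form f" shows "f (sum v A) = (\<Sum>a\<in>A. f (v a))"
  using Vector_Spaces.linear.axioms(3)[OF assms] module_hom.sum by blast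

lemma linear_form_zero: "linear_form f \<Longrightarrow> f 0 = 0"
  unfolding linear_form_iff by (metis mult_zero_left vec.scale_zero_left)

lemma linear_form_diff: "linear_form f \<Longrightarrow> f (x - y) = f x - f y"
  unfolding linear_form_iff by (metis add_diff_cancel diff_add_cancel)

lemma linear_form_scale: "linear_form f \<Longrightarrow> f (c *s x) = c * f x"
  by (simp add: linear_form_iff)

lemma subspace_kernel: "linear_form f \<Longrightarrow> vec.subspace {x. f x = 0}"
  using linear_form_zero[of f] by (auto simp: vec.subspace_def linear_form_iff)

lemma pg_points_iff: "P \<in> pg_points \<longleftrightarrow> (\<exists>x. x \<noteq> 0 \<and> P = vec.span {x})"
proof
  assume "P \<in> pg_points"
  then have P: "vec.subspace P" "vec.dim P = 1" by (auto simp: pg_points_def)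
  obtain B where B: "B \<subseteq> P" "vec.independent B" "P \<subseteq> vec.span B" "card B = 1"
    using vec.basis_exists[of P] P by metis
  then obtain x where x: "B = {x}" by (auto simp: card_1_singleton_iff)
  then have "x \<noteq> 0" using B vec.dependent_zero by blast
  moreover have "P = vec.span {x}" using B x P vec.span_minimal by blast
  ultimately show "\<exists>x. x \<noteq> 0 \<and> P = vec.span {x}" by blast
qed (auto simp: pg_points_def)

lemma span_singleton_subset: "vec.subspace U \<Longrightarrow> vec.span {x} \<subseteq> U \<longleftrightarrow> x \<in> U"
  by (meson empty_subsetI insert_subset subset_trans vec.span_minimal vec.span_superset)

lemma span_singleton_eqI:
  assumes "c \<noteq> 0" shows "vec.span {c *s x} = vec.span {x :: 'k::field ^ 'n}"
proof -
  have "x = (1 / c) *s (c *s x)" using assms by simp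
  then have "x \<in> vec.span {c *s x}" by (metis vec.span_base vec.span_scale singletonI)
  moreover have "c *s x \<in> vec.span {x}" by (simp add: vec.span_base vec.span_scale)
  ultimately show ?thesis by (simp add: subset_antisym span_singleton_subset)
qed

lemma span_singleton_cancel:
  assumes "x \<noteq> 0" "x \<in> vec.span {y}" shows "vec.span {x} = vec.span {y :: 'k::field ^ 'n}"
proof -
  obtain c where c: "x = c *s y" using assms(2) by (auto simp: vec.span_singleton)
  then have "c \<noteq> 0" using assms(1) by auto
  then show ?thesis using c span_singleton_eqI by blast
qed

text \<open>Subtracting \<open>f y / f x\<close> times \<open>x\<close> from \<open>y\<close> lands
  in the kernel, so the kernel together with \<open>x\<close> spans the space and has codimension
  one.\<close>

lemma kernel_hyperplane:
  fixes f :: "'k::field ^ 'n \<Rightarrow> 'k"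
  assumes f: "linear_form f" and x: "f x \<noteq> 0"
  shows "{P \<in> pg_points. P \<subseteq> {y. f y = 0}} \<in> pg_hyperplanes"
proof -
  let ?U = "{y. f y = 0}"
  have sub: "vec.subspace ?U" using subspace_kernel[OF f] .
  have "vec.span ?U = ?U" by (rule vec.span_eq_iff[THEN iffD2, OF sub])
  then have nx: "x \<notin> vec.span ?U" using x by blast
  have "y \<in> vec.span (insert x ?U)" for y
  proof -
    have "f (y - (f y / f x) *s x) = 0"
      using x linear_form_scale[OF f] by (simp add: linear_form_diff[OF f])
    then have "y - (f y / f x) *s x \<in> vec.span ?U" by (intro vec.span_base) simp
    then show ?thesis unfolding vec.span_breakdown_eq by blast
  qed
  then have "vec.span (insert x ?U) = UNIV" by blast
  then have "vec.dim (insert x ?U) = CARD('n)"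
    using vec.dim_span[of "insert x ?U"] by (simp add: card_cart_basis)
  moreover have "vec.dim (insert x ?U) = vec.dim ?U + 1" using nx by (subst vec.dim_insert) simp
  ultimately have "vec.dim ?U = CARD('n) - 1" by simp
  then show ?thesis unfolding pg_hyperplanes_def pg_flats_def using sub by blast
qed

text \<open>A basis of the span of \<open>S\<close> extends to the whole space by at least two
  vectors \<open>x\<close> and \<open>y\<close>. Their coordinate functions vanish on
  \<open>S\<close>, and the values at \<open>x\<close> and \<open>y\<close> show that they are
  independent.\<close>

lemma two_independent_forms:
  fixes S :: "('k::field ^ 'n) set"
  assumes "vec.dim S + 2 \<le> CARD('n)"
  obtains f g x y where "linear_form f" "linear_form g" "\<forall>s\<in>S. f s = 0" "\<forall>s\<in>S. g s = 0"
    "f x = 1" "g x = 0" "f y = 0" "g y = 1"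
proof -
  obtain B where B: "B \<subseteq> S" "vec.independent B" "S \<subseteq> vec.span B" "card B = vec.dim S"
    using vec.basis_exists[of S] by metis
  define C where "C = vec.extend_basis B"
  have C: "B \<subseteq> C" "vec.independent C" "vec.span C = UNIV"
    using vec.extend_basis_superset[OF B(2)] vec.independent_extend_basis[OF B(2)]
      vec.span_extend_basis[OF B(2)] unfolding C_def by blast+
  have cC: "card C = CARD('n)" using C vec.dim_eq_card_independent[OF C(2)]
    by (metis vec.dim_span vec_dim_card)
  have finC: "finite C" using C(2) vec.finiteI_independent by blast
  have "card (C - B) \<ge> 2" using assms cC B(4) C(1) finC
    by (subst card_Diff_subset) (auto intro: finite_subset)
  then obtain x y where xy: "x \<in> C - B" "y \<in> C - B" "x \<noteq> y"
    by (metis card_le_Suc0_iff_eq finC finite_Diff not_less_eq_eq numeral_2_eq_2)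
  let ?f = "\<lambda>z v. vec.representation C v z"
  have lin: "linear_form (?f z)" for z by (rule vec.linear_representation[OF C(2,3)])
  have rep: "?f z v = (if z = v then 1 else 0)" if "v \<in> C" for z v
    by (simp add: vec.representation_basis[OF C(2) that])
  have vanish: "?f z s = 0" if z: "z \<in> C - B" and s: "s \<in> S" for z s
  proof -
    have "B \<subseteq> {v. ?f z v = 0}" using z C(1) rep by auto
    then have "vec.span B \<subseteq> {v. ?f z v = 0}" using subspace_kernel[OF lin] vec.span_minimal by blast
    then show ?thesis using s B(3) by blast
  qed
  show thesis
    by (rule that[OF lin lin, of x y x y]) (use xy rep vanish in auto)
qed

section \<open>Bases with their dual coordinates\<close>

text \<open>A basis together with its dual basis, where only indices below 6 matter. In dimension 6
  duality alone forces \<open>b\<close> to be a basis.\<close>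

definition frame :: "(nat \<Rightarrow> 'k::field ^ 6) \<Rightarrow> (nat \<Rightarrow> 'k ^ 6 \<Rightarrow> 'k) \<Rightarrow> bool" where
  "frame b \<phi> \<longleftrightarrow> (\<forall>i<6. linear_form (\<phi> i)) \<and> (\<forall>i<6. \<forall>j<6. \<phi> i (b j) = (if i = j then 1 else 0))"

lemma frame_linear: "frame b \<phi> \<Longrightarrow> i < 6 \<Longrightarrow> linear_form (\<phi> i)"
  and frame_dual: "frame b \<phi> \<Longrightarrow> i < 6 \<Longrightarrow> j < 6 \<Longrightarrow> \<phi> i (b j) = (if i = j then 1 else 0)"
  by (simp_all add: frame_def)

text \<open>Duality makes the six vectors distinct and independent, hence spanning, and
  \<open>\<phi> i\<close> reads off the coefficient of \<open>b i\<close>.\<close>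

lemma frame_expansion:
  assumes "frame b \<phi>" shows "(\<Sum>i<6. \<phi> i x *s b i) = x"
proof -
  have lin: "\<And>i. i < 6 \<Longrightarrow> linear_form (\<phi> i)"
    and dual: "\<And>i j. i < 6 \<Longrightarrow> j < 6 \<Longrightarrow> \<phi> i (b j) = (if i = j then 1 else 0)"
    using assms by (auto simp: frame_def)
  have inj: "inj_on b {..<6}"
    by (rule inj_onI) (metis dual lessThan_iff zero_neq_one)
  have coeff: "\<phi> i (\<Sum>j<6. u j *s b j) = u i" if "i < 6" for i u
  proof -
    have "\<phi> i (\<Sum>j<6. u j *s b j) = (\<Sum>j<6. u j * \<phi> i (b j))"
      unfolding linear_form_sum[OF lin[OF that]] using lin[OF that] by (simp add: linear_form_iff)
    also have "\<dots> = (\<Sum>j<6. if i = j then u j else 0)"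
      by (rule sum.cong) (use dual that in auto)
    finally show ?thesis using that by simp
  qed
  have "vec.independent (b ` {..<6})"
    unfolding vec.independent_explicit
  proof (intro conjI allI impI ballI)
    fix c v assume c: "(\<Sum>v\<in>b ` {..<6}. c v *s v) = 0" and "v \<in> b ` {..<6}"
    then obtain i where i: "i < 6" "v = b i" by auto
    have "(\<Sum>j<6. c (b j) *s b j) = 0" using c by (simp add: sum.reindex[OF inj])
    then show "c v = 0" using coeff[OF i(1), of "\<lambda>j. c (b j)"] i linear_form_zero[OF lin[OF i(1)]] by simp
  qed simp
  then have "UNIV \<subseteq> vec.span (b ` {..<6})"
    by (intro vec.card_ge_dim_independent) (simp_all add: card_image[OF inj] vec_dim_card card_cart_basis)
  then obtain u where "x = (\<Sum>v\<in>b ` {..<6}. u v *s v)"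
    by (subst (asm) vec.span_finite) auto
  then have x: "x = (\<Sum>j<6. u (b j) *s b j)" by (simp add: sum.reindex[OF inj])
  show ?thesis
    by (subst (2) x, rule sum.cong) (use coeff[of _ "\<lambda>j. u (b j)"] x in auto)
qed

lemma basis_frame:
  fixes b :: "nat \<Rightarrow> 'k::field ^ 6"
  assumes inj: "inj_on b {..<6}" and ind: "vec.independent (b ` {..<6})"
  shows "\<exists>\<phi>. frame b \<phi>"
proof -
  let ?B = "b ` {..<6}"
  have "UNIV \<subseteq> vec.span ?B"
    by (rule vec.card_ge_dim_independent)
      (simp_all add: card_image[OF inj] vec_dim_card card_cart_basis ind)
  then have sp: "vec.span ?B = UNIV" by blast
  have "frame b (\<lambda>i v. vec.representation ?B v (b i))"
    unfolding frame_def
    using vec.linear_representation[OF ind sp] inj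
    by (auto simp: vec.representation_basis[OF ind] inj_on_eq_iff)
  then show ?thesis by blast
qed

section \<open>Normal form of the point set\<close>

text \<open>The columns of the usual generator matrix of the extended ternary Golay code, taken as
  points in the basis \<open>b\<close>. For \<open>l = 5\<close> the last family contributes the
  point of \<open>b 5\<close> itself.\<close>

definition golay_points :: "(nat \<Rightarrow> 'k::field ^ 6) \<Rightarrow> ('k ^ 6) set set" where
  "golay_points b = (\<lambda>i. vec.span {b i}) ` {..<5} \<union> {vec.span {\<Sum>i<5. b i}} \<union>
     (\<lambda>l. vec.span {b 5 + (\<Sum>i<5. pentagon i l *s b i)}) ` {..<6}"

text \<open>Each of \<open>f\<close>, \<open>g\<close>, \<open>f + g\<close>, \<open>f - g\<close>
  has at least five zeros in \<open>K\<close>, hence six. Adding up gives 24 = 12 + 3 *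
  \<open>card Z\<close>, so there are only four common zeros.\<close>

lemma no_five_common_zeros:
  fixes r :: "'p \<Rightarrow> 'k::field ^ 'n" and f g :: "'k ^ 'n \<Rightarrow> 'k"
  assumes k3: "CARD('k) = 3" and K: "card K = 12"
    and zeros: "\<And>f x. linear_form f \<Longrightarrow> f x \<noteq> 0 \<Longrightarrow> card {P \<in> K. f (r P) = 0} \<in> {0, 3, 6}"
    and f: "linear_form f" and g: "linear_form g"
    and T: "T \<subseteq> K" "card T = 5" "\<And>P. P \<in> T \<Longrightarrow> f (r P) = 0" "\<And>P. P \<in> T \<Longrightarrow> g (r P) = 0"
    and xy: "f x = 1" "g x = 0" "f y = 0" "g y = 1"
  shows False
proof -
  have fin: "finite K" using K by (intro card_ge_0_finite) simp
  have six: "card {P \<in> K. h (r P) = 0} = 6"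
    if h: "linear_form h" "h v \<noteq> 0" "\<And>P. P \<in> T \<Longrightarrow> h (r P) = 0" for h v
  proof -
    have "card T \<le> card {P \<in> K. h (r P) = 0}"
      by (rule card_mono) (use fin T(1) h(3) in auto)
    then show ?thesis using zeros[OF h(1,2)] T(2) by auto
  qed
  have lin: "linear_form (\<lambda>v. f v + g v)" "linear_form (\<lambda>v. f v - g v)"
    using f g by (auto simp: linear_form_iff algebra_simps)
  define Z where "Z = {P \<in> K. f (r P) = 0 \<and> g (r P) = 0}"
  have "T \<subseteq> Z" using T by (auto simp: Z_def)
  moreover have "finite Z" using fin by (simp add: Z_def)
  ultimately have Z5: "card Z \<ge> 5" using card_mono[of Z T] T(2) by simp
  have count: "card {P \<in> K. p P} = (\<Sum>P\<in>K. of_bool (p P))" for p :: "'p \<Rightarrow> bool"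
    using fin by (simp add: Collect_conj_eq)
  \<comment> \<open>Off the common zeros, exactly one of the forms \<open>f\<close>, \<open>g\<close>, \<open>f + g\<close>, \<open>f - g\<close> vanishes.\<close>
  have "of_bool (a = 0) + of_bool (b = 0) + of_bool (a + b = 0) + of_bool (a - b = 0) =
      1 + 3 * (of_bool (a = 0 \<and> b = 0) :: nat)" for a b :: 'k
    using gf3_cases(1)[OF k3, of a] gf3_cases(1)[OF k3, of b] gf3_cases(3)[OF k3]
    by (elim disjE; simp add: gf3_numeral[OF k3])
  then have "(\<Sum>P\<in>K. of_bool (f (r P) = 0) + of_bool (g (r P) = 0) +
      of_bool (f (r P) + g (r P) = 0) + of_bool (f (r P) - g (r P) = 0)) =
    (\<Sum>P\<in>K. 1 + 3 * (of_bool (f (r P) = 0 \<and> g (r P) = 0) :: nat))"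
    by simp
  then have "card {P \<in> K. f (r P) = 0} + card {P \<in> K. g (r P) = 0} +
      card {P \<in> K. f (r P) + g (r P) = 0} + card {P \<in> K. f (r P) - g (r P) = 0} =
    card K + 3 * card Z"
    unfolding count Z_def by (simp only: sum.distrib sum_distrib_left[symmetric] card_eq_sum)
  moreover have "card {P \<in> K. f (r P) = 0} = 6" "card {P \<in> K. g (r P) = 0} = 6"
    using six[OF f, of x] six[OF g, of y] T xy by simp_all
  moreover have "card {P \<in> K. f (r P) + g (r P) = 0} = 6" "card {P \<in> K. f (r P) - g (r P) = 0} = 6"
    using six[OF lin(1), of x] six[OF lin(2), of x] T xy by simp_all
  ultimately show False using Z5 K by simp
qed

text \<open>If the five representatives spanned less than dimension five, two independent forms
  would vanish on all of them. Any vector \<open>e\<close> outside their span completes the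
  basis.\<close>

lemma five_points_frame:
  fixes r :: "'p \<Rightarrow> 'k::field ^ 6"
  assumes k3: "CARD('k) = 3" and K: "card K = 12"
    and zeros: "\<And>f x. linear_form f \<Longrightarrow> f x \<noteq> 0 \<Longrightarrow> card {P \<in> K. f (r P) = 0} \<in> {0, 3, 6}"
    and P: "\<And>i. i < 5 \<Longrightarrow> P i \<in> K" and inj: "inj_on P {..<5}"
  obtains e \<phi> where "frame (\<lambda>i. if i < 5 then r (P i) else e) \<phi>"
proof -
  let ?T = "P ` {..<5::nat}" and ?S = "(\<lambda>i. r (P i)) ` {..<5::nat}"
  have T: "?T \<subseteq> K" "card ?T = 5" using P inj by (auto simp: card_image)
  have "vec.dim ?S = 5"
  proof (rule ccontr)
    assume "vec.dim ?S \<noteq> 5"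
    moreover have "vec.dim ?S \<le> 5"
      using vec.dim_le_card'[of ?S] card_image_le[of "{..<5}" "\<lambda>i. r (P i)"] by simp
    ultimately have "vec.dim ?S + 2 \<le> CARD(6)" by simp
    then obtain f g x y where fg: "linear_form f" "linear_form g"
      "\<forall>s\<in>?S. f s = 0" "\<forall>s\<in>?S. g s = 0"
      "f x = 1" "g x = 0" "f y = 0" "g y = 1"
      by (rule two_independent_forms)
    show False by (rule no_five_common_zeros[where r = r, OF k3 K zeros fg(1,2) T _ _ fg(5-8)]) (use fg(3,4) in auto)
  qed
  moreover have "card ?S \<le> 5" using card_image_le[of "{..<5}" "\<lambda>i. r (P i)"] by simp
  moreover have "vec.dim ?S \<le> card ?S" by (intro vec.dim_le_card') simp
  ultimately have cS: "card ?S = 5" "vec.dim ?S = 5" by simp_all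
  then have indS: "vec.independent ?S"
    by (intro vec.card_le_dim_spanning[of ?S ?S]) (simp_all add: cS vec.span_superset)
  have "vec.span ?S \<noteq> UNIV"
  proof
    assume "vec.span ?S = UNIV"
    then show False using vec.dim_span[of ?S] cS by (simp add: card_cart_basis)
  qed
  then obtain e where e: "e \<notin> vec.span ?S" by blast
  let ?b = "\<lambda>i. if i < 5 then r (P i) else e"
  have im: "?b ` {..<6} = insert e ?S"
  proof -
    have "{..<6} = insert 5 {..<5::nat}" by auto
    then show ?thesis by auto
  qed
  have ind: "vec.independent (?b ` {..<6})" unfolding im by (rule vec.independent_insertI[OF e indS])
  have "e \<notin> ?S" using e vec.span_superset[of ?S] by blast
  then have "card (?b ` {..<6}) = 6" unfolding im using cS by simp
  then have "inj_on ?b {..<6}" by (intro eq_card_imp_inj_on) simp_all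
  then obtain \<phi> where "frame ?b \<phi>" using basis_frame[OF _ ind] by blast
  then show thesis by (rule that)
qed

text \<open>The five points give basis vectors up to scalars, the sixth point of their hyperplane
  fixes these scalars up to a common factor, and the six points off the hyperplane determine the
  last basis vector.\<close>

lemma golay_normal_form:
  fixes K :: "('k::field ^ 6) set set"
  assumes k3: "CARD('k) = 3" and Kpts: "K \<subseteq> pg_points" and K: "card K = 12"
    and hyp: "\<forall>H \<in> pg_hyperplanes. card (H \<inter> K) \<in> {0, 3, 6}"
    and P: "\<And>i. i < 5 \<Longrightarrow> P i \<in> K" and inj: "inj_on P {..<5::nat}"
  obtains b \<phi> where "frame b \<phi>" and "\<forall>i<5. P i = vec.span {b i}" and "K = golay_points b"
proof -
  note two = gf3_cases(2)[OF k3]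
  have fin: "finite K" using K by (intro card_ge_0_finite) simp
  have "\<forall>X\<in>K. \<exists>x. x \<noteq> 0 \<and> X = vec.span {x}" using Kpts pg_points_iff by blast
  then obtain r where r: "\<And>X. X \<in> K \<Longrightarrow> r X \<noteq> 0 \<and> X = vec.span {r X}" by metis
  \<comment> \<open>A point lies in the kernel of \<open>f\<close> exactly when its representative
    does, so the hyperplane condition becomes a count of zeros.\<close>
  have zeros: "card {X \<in> K. f (r X) = 0} \<in> {0, 3, 6}" if f: "linear_form f" and x: "f x \<noteq> 0" for f x
  proof -
    have "X \<subseteq> {y. f y = 0} \<longleftrightarrow> f (r X) = 0" if "X \<in> K" for X
      using span_singleton_subset[OF subspace_kernel[OF f], of "r X"] r[OF that] by simp
    then have "{X \<in> pg_points. X \<subseteq> {y. f y = 0}} \<inter> K = {X \<in> K. f (r X) = 0}"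
      using Kpts by blast
    then show ?thesis using bspec[OF hyp kernel_hyperplane[OF f x]] by simp
  qed
  obtain e \<phi>0 where fr: "frame (\<lambda>i. if i < 5 then r (P i) else e) \<phi>0"
    by (rule five_points_frame[OF k3 K zeros P inj])
  define v where "v i = r (P i)" for i
  have lin0: "linear_form (\<phi>0 i)" if "i < 6" for i using frame_linear[OF fr that] .
  have dual0: "\<phi>0 i (v j) = (if i = j then 1 else 0)" if "i < 6" "j < 5" for i j
    using frame_dual[OF fr that(1), of j] that by (simp add: v_def)
  have e0: "\<phi>0 i e = 0" if "i < 5" for i
    using frame_dual[OF fr, of i 5] that by simp
  have e5: "\<phi>0 5 e = 1"
    using frame_dual[OF fr, of 5 5] by simp
  \<comment> \<open>The kernel of \<open>h\<close> is the span of the five given points.\<close>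
  define h where "h = \<phi>0 5"
  have linh: "linear_form h" using lin0 by (simp add: h_def)
  have hv: "h (v i) = 0" if "i < 5" for i using dual0[of 5 i] that by (simp add: h_def)
  define Z where "Z = {X \<in> K. h (r X) = 0}"
  let ?T = "P ` {..<5::nat}"
  have T: "card ?T = 5" "?T \<subseteq> Z" using inj P hv by (auto simp: card_image Z_def v_def)
  have finZ: "finite Z" using fin by (simp add: Z_def)
  have "card Z \<in> {0, 3, 6}" using zeros[OF linh, of e] e5 by (simp add: Z_def h_def)
  moreover have "card ?T \<le> card Z" using T finZ by (intro card_mono)
  ultimately have Z6: "card Z = 6" using T by auto
  then have "card (Z - ?T) = 1" using T by (simp add: card_Diff_subset)
  then obtain Q where Q: "Z - ?T = {Q}" by (auto simp: card_1_singleton_iff)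
  then have Z: "Z = insert Q ?T" and QT: "Q \<notin> ?T" using T by blast+
  have QK: "Q \<in> K" and hQ: "h (r Q) = 0" using Q by (auto simp: Z_def)
  define c where "c i = \<phi>0 i (r Q)" for i
  have rQ: "r Q = (\<Sum>i<5. c i *s v i)"
  proof -
    have "{..<6} = insert 5 {..<5::nat}" by auto
    then show ?thesis
      using frame_expansion[OF fr, of "r Q"] hQ by (simp add: c_def h_def v_def)
  qed
  \<comment> \<open>Otherwise \<open>\<phi>0 i\<close> and \<open>h\<close> would both vanish at
    \<open>Q\<close> and at the four given points other than \<open>P i\<close>.\<close>
  have c: "c i \<noteq> 0" if i: "i < 5" for i
  proof
    assume c0: "c i = 0"
    let ?T' = "insert Q (P ` ({..<5} - {i}))"
    have "card (P ` ({..<5} - {i})) = 4"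
      using i by (subst card_image[OF inj_on_subset[OF inj]]) auto
    moreover have "Q \<notin> P ` ({..<5} - {i})" using QT by blast
    ultimately have T': "card ?T' = 5" by simp
    have T'K: "?T' \<subseteq> K" using P QK by auto
    have van: "\<phi>0 i (r X) = 0" "h (r X) = 0" if "X \<in> ?T'" for X
      using that c0 dual0[of i] i hQ hv by (auto simp: c_def v_def split: if_splits)
    have vals: "\<phi>0 i (v i) = 1" "h (v i) = 0" "\<phi>0 i e = 0" "h e = 1"
      using dual0[of i i] i hv e0 e5 by (simp_all add: h_def)
    have lini: "linear_form (\<phi>0 i)" using lin0 i by simp
    show False
      by (rule no_five_common_zeros[where r = r, OF k3 K zeros lini linh T'K T' van vals])
  qed
  \<comment> \<open>With this scaling \<open>r Q\<close> is the sum of the five basis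
    vectors.\<close>
  define b where "b i = c i *s v i" for i
  define f where "f i x = \<phi>0 i x / c i" for i x
  have linf: "linear_form (f i)" if "i < 5" for i
    using lin0[of i] that by (auto simp: linear_form_iff f_def add_divide_distrib)
  have fb: "f i (b j) = (if i = j then 1 else 0)" if "i < 5" "j < 5" for i j
    using dual0[of i j] that c[of i] lin0[of i] by (auto simp: f_def b_def linear_form_iff)
  have hb: "h (b j) = 0" if "j < 5" for j
    using hv[OF that] linear_form_scale[OF linh] by (simp add: b_def)
  have u: "r Q = (\<Sum>i<5. b i)" using rQ by (simp add: b_def)
  define W where "W = K - Z"
  have W6: "card W = 6" using Z6 K finZ by (simp add: W_def card_Diff_subset Z_def)
  have hW: "h (r w) \<noteq> 0" if "w \<in> W" for w using that by (auto simp: W_def Z_def)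
  have span_b: "P i = vec.span {b i}" if "i < 5" for i
    using r[OF P[OF that]] span_singleton_eqI[OF c[OF that], of "v i"] by (simp add: b_def v_def)
  \<comment> \<open>The zeros of a form are split among the five given points, the point
    \<open>Q\<close> and the six points of \<open>W\<close>.\<close>
  have count: "card {i \<in> {..<5}. F (b i) = 0} + of_bool ((\<Sum>i<5. F (b i)) = 0) +
      card {w \<in> W. F (r w) = 0} \<in> {0, 3, 6}"
    if F: "linear_form F" and y: "F y \<noteq> 0" for F y
  proof -
    have Fv: "F (v i) = 0 \<longleftrightarrow> F (b i) = 0" if "i < 5" for i
      using c[OF that] linear_form_scale[OF F] by (simp add: b_def)
    have "{X \<in> K. F (r X) = 0} =
      P ` {i \<in> {..<5}. F (b i) = 0} \<union> ({X. X = Q \<and> F (r X) = 0} \<union> {w \<in> W. F (r w) = 0})"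
      using Fv P QK Z by (auto simp: W_def v_def)
    moreover have "card (P ` {i \<in> {..<5}. F (b i) = 0} \<union> ({X. X = Q \<and> F (r X) = 0} \<union> {w \<in> W. F (r w) = 0})) =
      card {i \<in> {..<5}. F (b i) = 0} + (of_bool (F (r Q) = 0) + card {w \<in> W. F (r w) = 0})"
    proof -
      have "card (P ` {i \<in> {..<5}. F (b i) = 0}) = card {i \<in> {..<5}. F (b i) = 0}"
        by (rule card_image) (rule inj_on_subset[OF inj], auto)
      moreover have "card ({X. X = Q \<and> F (r X) = 0}) = of_bool (F (r Q) = 0)"
      proof -
        have "{X. X = Q \<and> F (r X) = 0} = (if F (r Q) = 0 then {Q} else {})" by auto
        then show ?thesis by simp
      qed
      ultimately show ?thesis
        using fin QT by (subst card_Un_disjoint; (subst card_Un_disjoint)?) (auto simp: W_def Z)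
    qed
    moreover have "F (r Q) = (\<Sum>i<5. F (b i))" unfolding u linear_form_sum[OF F] ..
    ultimately show ?thesis using zeros[OF F y] by (simp add: add.assoc)
  qed
  \<comment> \<open>These are affine coordinates on the complement of the hyperplane; they do not
    depend on the representatives.\<close>
  define g where "g i w = f i (r w) / h (r w)" for i w
  have bal: "card {w \<in> W. g i w = a} = 2" if i: "i < 5" for i a
  proof -
    \<comment> \<open>This form vanishes at four of the five given points and has value 1 at
      \<open>r Q\<close>. A total of 0, 3 or 6 leaves exactly two zeros in \<open>W\<close>.\<close>
    let ?F = "\<lambda>x. f i x - a * h x"
    have F: "linear_form ?F" using linf[OF i] linh by (auto simp: linear_form_iff algebra_simps)
    have Fb: "?F (b j) = (if i = j then 1 else 0)" if "j < 5" for j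
      using fb[OF i that] hb[OF that] by simp
    have "{j \<in> {..<5}. ?F (b j) = 0} = {..<5} - {i}"
      using fb[OF i] hb i by (auto split: if_splits)
    then have c4: "card {j \<in> {..<5}. ?F (b j) = 0} = 4" using i by simp
    have "(\<Sum>j<5. ?F (b j)) = (\<Sum>j<5. if i = j then 1 else 0)" by (rule sum.cong) (use Fb in auto)
    then have s: "(\<Sum>j<5. ?F (b j)) = 1" using i by simp
    have eq: "{w \<in> W. ?F (r w) = 0} = {w \<in> W. g i w = a}"
      using hW by (auto simp: g_def field_simps)
    have "?F (b i) \<noteq> 0" using Fb[OF i] by simp
    from count[OF F this] show ?thesis unfolding c4 s eq by auto
  qed
  have sum: "card {w \<in> W. g i w + g j w = a} \<in> {0, 3}" if ij: "i < 5" "j < 5" "i \<noteq> j" for i j a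
  proof -
    \<comment> \<open>Three of the five given points are zeros, and the value at \<open>r Q\<close>
      is \<open>1 + 1 = -1\<close>. So \<open>W\<close> contains none or three zeros.\<close>
    let ?F = "\<lambda>x. f i x + f j x - a * h x"
    have F: "linear_form ?F"
      using linf[OF ij(1)] linf[OF ij(2)] linh by (auto simp: linear_form_iff algebra_simps)
    have Fb: "?F (b l) = (if l = i then 1 else 0) + (if l = j then 1 else 0)" if "l < 5" for l
      using fb[OF ij(1) that] fb[OF ij(2) that] hb[OF that] by simp
    have "{l \<in> {..<5}. ?F (b l) = 0} = {..<5} - {i, j}" 
      using fb[OF ij(1)] fb[OF ij(2)] hb ij by (auto split: if_splits)
    moreover have "card ({..<5} - {i, j}) = card {..<5::nat} - card {i, j}"
      by (rule card_Diff_subset) (use ij in auto)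
    ultimately have c3: "card {l \<in> {..<5}. ?F (b l) = 0} = 3" using ij(3) by simp
    have "(\<Sum>l<5. ?F (b l)) = (\<Sum>l<5. (if l = i then 1 else 0) + (if l = j then 1 else 0))"
      by (rule sum.cong) (use fb[OF ij(1)] fb[OF ij(2)] hb in auto)
    also have "\<dots> = 1 + 1" using ij unfolding sum.distrib by simp
    finally have s: "(\<Sum>l<5. ?F (b l)) = -1" unfolding two .
    have eq: "{w \<in> W. ?F (r w) = 0} = {w \<in> W. g i w + g j w = a}"
      using hW by (auto simp: g_def field_simps)
    have "?F (b i) \<noteq> 0" using Fb[OF ij(1)] ij(3) by simp
    from count[OF F this] show ?thesis unfolding c3 s eq by auto
  qed
  obtain \<omega> \<epsilon> where \<omega>: "bij_betw \<omega> {..<6} W" and \<epsilon>: "\<epsilon> * \<epsilon> = 1"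
    and gp: "\<forall>i<5. \<forall>k<6. g i (\<omega> k) - g i (\<omega> 5) = \<epsilon> * pentagon i k"
    by (rule six_points_normal_form[OF k3 W6 bal sum])
  have \<omega>W: "\<omega> k \<in> W" if "k < 6" for k using \<omega> that by (auto simp: bij_betw_def)
  have \<epsilon>0: "\<epsilon> \<noteq> 0" using \<epsilon> by auto
  \<comment> \<open>With this factor \<open>\<epsilon> * h\<close> takes the value 1 on the rescaled
    representatives, because \<open>\<epsilon>\<close> is its own inverse.\<close>
  define s where "s k = \<epsilon> / h (r (\<omega> k))" for k
  have s0: "s k \<noteq> 0" if "k < 6" for k using hW[OF \<omega>W[OF that]] \<epsilon>0 by (simp add: s_def)
  define b' where "b' i = (if i = 5 then s 5 *s r (\<omega> 5) else b i)" for i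
  \<comment> \<open>The subtracted multiple of \<open>h\<close> moves the affine origin to
    \<open>\<omega> 5\<close>, which becomes the last basis point.\<close>
  define \<phi> where "\<phi> i x = (if i = 5 then \<epsilon> * h x else f i x - g i (\<omega> 5) * h x)" for i x
  have \<phi>s: "\<phi> i (s k *s r (\<omega> k)) = (if i = 5 then 1 else pentagon i k)" if "i < 6" "k < 6" for i k
  proof (cases "i = 5")
    case True
    then show ?thesis using linear_form_scale[OF linh] hW[OF \<omega>W[OF that(2)]] \<epsilon>
      by (simp add: \<phi>_def s_def)
  next
    case False
    then have i: "i < 5" using that by simp
    have "\<phi> i (s k *s r (\<omega> k)) = \<epsilon> * (g i (\<omega> k) - g i (\<omega> 5))"
      using False hW[OF \<omega>W[OF that(2)]]
      by (simp add: \<phi>_def s_def g_def linear_form_scale[OF linh] linear_form_scale[OF linf[OF i]] field_simps)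
    also have "\<dots> = pentagon i k" using gp i that(2) \<epsilon> by (simp add: mult.assoc[symmetric])
    finally show ?thesis using False by simp
  qed
  have frame: "frame b' \<phi>"
    unfolding frame_def
  proof (intro conjI allI impI)
    fix i :: nat assume "i < 6"
    show "linear_form (\<phi> i)"
    proof (cases "i = 5")
      case True
      then show ?thesis using linh by (auto simp: linear_form_iff \<phi>_def algebra_simps)
    next
      case False
      then have "i < 5" using \<open>i < 6\<close> by simp
      then show ?thesis using False linf[of i] linh by (auto simp: linear_form_iff \<phi>_def algebra_simps)
    qed
  next
    fix i j :: nat assume ij: "i < 6" "j < 6"
    show "\<phi> i (b' j) = (if i = j then 1 else 0)"
    proof (cases "j = 5")
      case True
      then show ?thesis using \<phi>s[OF ij(1), of 5] by (simp add: b'_def pentagon_def)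
    next
      case False
      then have "j < 5" using ij by simp
      moreover have "i = 5 \<or> i < 5" using ij by auto
      ultimately show ?thesis using fb[of i j] hb[of j] by (auto simp: \<phi>_def b'_def)
    qed
  qed
  have six: "{..<6} = insert 5 {..<5::nat}" by auto
  have span_w: "\<omega> k = vec.span {b' 5 + (\<Sum>i<5. pentagon i k *s b' i)}" if k: "k < 6" for k
  proof -
    have "s k *s r (\<omega> k) = (\<Sum>i<6. \<phi> i (s k *s r (\<omega> k)) *s b' i)"
      using frame_expansion[OF frame] by metis
    also have "\<dots> = b' 5 + (\<Sum>i<5. pentagon i k *s b' i)"
      unfolding six using \<phi>s[OF _ k] by (simp add: six)
    finally have "b' 5 + (\<Sum>i<5. pentagon i k *s b' i) = s k *s r (\<omega> k)" ..
    then show ?thesis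
      using span_singleton_eqI[OF s0[OF k], of "r (\<omega> k)"] r[of "\<omega> k"] \<omega>W[OF k] by (auto simp: W_def)
  qed
  have span_b': "P i = vec.span {b' i}" if "i < 5" for i using span_b[OF that] that by (simp add: b'_def)
  have "K = Z \<union> W" by (auto simp: Z_def W_def)
  also have "Z = (\<lambda>i. vec.span {b' i}) ` {..<5} \<union> {vec.span {\<Sum>i<5. b' i}}"
  proof -
    have "(\<Sum>i<5. b' i) = r Q" unfolding u by (rule sum.cong) (auto simp: b'_def)
    then have "Q = vec.span {\<Sum>i<5. b' i}" using r[OF QK] by simp
    then show ?thesis unfolding Z using span_b' by auto
  qed
  also have "W = (\<lambda>l. vec.span {b' 5 + (\<Sum>i<5. pentagon i l *s b' i)}) ` {..<6}"
    using \<omega> span_w by (auto simp: bij_betw_def)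
  finally have "K = golay_points b'" by (simp add: golay_points_def)
  with frame show thesis using span_b' by (intro that) blast+
qed

section \<open>Coordinates of the twelve points\<close>

lemma frame_eqI:
  assumes "frame b \<phi>" "\<And>i. i < 6 \<Longrightarrow> \<phi> i x = \<phi> i y" shows "x = y"
proof -
  have "(\<Sum>i<6. \<phi> i x *s b i) = (\<Sum>i<6. \<phi> i y *s b i)" by (rule sum.cong) (use assms(2) in auto)
  then show ?thesis unfolding frame_expansion[OF assms(1)] .
qed

lemma frame_coord_sum:
  assumes "frame b \<phi>" "i < 6" "S \<subseteq> {..<6}"
  shows "\<phi> i (\<Sum>j\<in>S. c j *s b j) = (if i \<in> S then c i else 0)"
proof -
  have S: "finite S" using assms(3) finite_subset by blast
  have "\<phi> i (\<Sum>j\<in>S. c j *s b j) = (\<Sum>j\<in>S. c j * \<phi> i (b j))"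
    unfolding linear_form_sum[OF frame_linear[OF assms(1,2)]]
      linear_form_scale[OF frame_linear[OF assms(1,2)]] ..
  also have "\<dots> = (\<Sum>j\<in>S. if i = j then c j else 0)"
    by (rule sum.cong) (use frame_dual[OF assms(1,2)] assms(3) in auto)
  also have "\<dots> = (if i \<in> S then c i else 0)" using S by simp
  finally show ?thesis .
qed

lemma frame_coord_hexad:
  assumes "frame b \<phi>" "i < 6"
  shows "\<phi> i (\<Sum>j<5. b j) = (if i = 5 then 0 else 1)"
  using frame_coord_sum[OF assms, of "{..<5}" "\<lambda>_. 1"] assms(2) by auto

lemma frame_coord_pentagon:
  assumes "frame b \<phi>" "i < 6"
  shows "\<phi> i (b 5 + (\<Sum>j<5. pentagon j l *s b j)) = (if i = 5 then 1 else pentagon i l)"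
proof -
  have "\<phi> i (b 5 + (\<Sum>j<5. pentagon j l *s b j)) = \<phi> i (b 5) + \<phi> i (\<Sum>j<5. pentagon j l *s b j)"
    using frame_linear[OF assms] by (simp add: linear_form_iff)
  then show ?thesis
    using frame_coord_sum[OF assms, of "{..<5}" "\<lambda>j. pentagon j l"] frame_dual[OF assms, of 5] assms(2) by auto
qed

section \<open>Linear collineations\<close>

text \<open>\<open>L\<close> keeps the coordinates and exchanges the basis \<open>b\<close> for
  \<open>b'\<close>; \<open>M\<close> does the reverse.\<close>

lemma frame_map:
  assumes F: "frame b \<phi>" and F': "frame b' \<phi>'"
  obtains L M where "Vector_Spaces.linear (*s) (*s) L" "Vector_Spaces.linear (*s) (*s) M"
    "\<forall>x. M (L x) = x" "\<forall>x. L (M x) = x" "\<forall>i<6. L (b i) = b' i" "\<forall>i<6. M (b' i) = b i"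
proof -
  define L where "L x = (\<Sum>i<6. \<phi> i x *s b' i)" for x
  define M where "M x = (\<Sum>i<6. \<phi>' i x *s b i)" for x
  have lin: "Vector_Spaces.linear (*s) (*s) (\<lambda>x. \<Sum>i<6. \<phi> i x *s b' i)" if "frame b \<phi>"
    for b b' :: "nat \<Rightarrow> 'a ^ 6" and \<phi>
    unfolding Vector_Spaces.linear_iff
  proof (intro conjI allI)
    show "(\<Sum>i<6. \<phi> i (x + y) *s b' i) = (\<Sum>i<6. \<phi> i x *s b' i) + (\<Sum>i<6. \<phi> i y *s b' i)" for x y
      unfolding sum.distrib[symmetric]
      by (rule sum.cong) (use frame_linear[OF that] in \<open>auto simp: linear_form_iff vec.scale_left_distrib\<close>)
    show "(\<Sum>i<6. \<phi> i (c *s x) *s b' i) = c *s (\<Sum>i<6. \<phi> i x *s b' i)" for c x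
      unfolding vec.scale_sum_right
      by (rule sum.cong) (use frame_linear[OF that] in \<open>auto simp: linear_form_iff\<close>)
  qed (rule vec.vector_space_axioms)+
  have \<phi>'L: "\<phi>' i (L x) = \<phi> i x" if "i < 6" for i x
    using frame_coord_sum[OF F' that, of "{..<6}"] that by (simp add: L_def)
  have \<phi>M: "\<phi> i (M x) = \<phi>' i x" if "i < 6" for i x
    using frame_coord_sum[OF F that, of "{..<6}"] that by (simp add: M_def)
  show thesis
  proof (rule that)
    show "Vector_Spaces.linear (*s) (*s) L" "Vector_Spaces.linear (*s) (*s) M"
      using lin[OF F] lin[OF F'] by (simp_all add: L_def[abs_def] M_def[abs_def])
    show "\<forall>x. M (L x) = x" by (intro allI frame_eqI[OF F]) (simp add: \<phi>M \<phi>'L)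
    show "\<forall>x. L (M x) = x" by (intro allI frame_eqI[OF F']) (simp add: \<phi>M \<phi>'L)
    show "\<forall>i<6. L (b i) = b' i"
      by (intro allI impI frame_eqI[OF F']) (simp add: \<phi>'L frame_dual[OF F] frame_dual[OF F'])
    show "\<forall>i<6. M (b' i) = b i"
      by (intro allI impI frame_eqI[OF F]) (simp add: \<phi>M frame_dual[OF F] frame_dual[OF F'])
  qed
qed

lemma linear_image_point:
  assumes "Vector_Spaces.linear (*s) (*s) L" shows "L ` vec.span {x} = vec.span {L x}"
  using vec.linear_span_image[OF assms, of "{x}"] by simp

lemma linear_image_pg_points:
  assumes L: "Vector_Spaces.linear (*s) (*s) L" and inv: "\<forall>x. M (L x) = x"
    and M: "Vector_Spaces.linear (*s) (*s) M" and X: "X \<in> pg_points"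
  shows "L ` X \<in> pg_points"
proof -
  obtain x where x: "x \<noteq> 0" "X = vec.span {x}" using X pg_points_iff by blast
  have "L x \<noteq> 0" using x inv vec.linear_0[OF M] by metis
  then show ?thesis using linear_image_point[OF L, of x] x pg_points_iff by blast
qed

lemma golay_points_image:
  fixes L :: "'k::field ^ 6 \<Rightarrow> 'k ^ 6"
  assumes L: "Vector_Spaces.linear (*s) (*s) L" and b: "\<forall>i<6. L (b i) = b' i"
  shows "(`) L ` golay_points b = golay_points b'"
proof -
  have s: "L (\<Sum>i<5. c i *s b i) = (\<Sum>i<5. c i *s b' i)" for c
    unfolding vec.linear_sum[OF L] by (rule sum.cong) (use b vec.linear_scale[OF L] in auto)
  have u: "L (\<Sum>i<5. b i) = (\<Sum>i<5. b' i)"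
    unfolding vec.linear_sum[OF L] by (rule sum.cong) (use b in auto)
  have "(\<lambda>x. vec.span {L (b x)}) ` {..<5} = (\<lambda>x. vec.span {b' x}) ` {..<5}"
    by (rule image_cong) (use b in auto)
  moreover have "L (b 5) = b' 5" using b by simp
  ultimately show ?thesis
    by (simp add: golay_points_def image_Un image_image linear_image_point[OF L] vec.linear_add[OF L] s u)
qed

lemma linear_collineation:
  fixes L M :: "'k::field ^ 'n \<Rightarrow> 'k ^ 'n"
  assumes L: "Vector_Spaces.linear (*s) (*s) L" and M: "Vector_Spaces.linear (*s) (*s) M"
    and inv1: "\<forall>x. M (L x) = x" and inv2: "\<forall>x. L (M x) = x"
  shows "pg_collineation (restrict ((`) L) pg_points)"
proof -
  note pt = linear_image_pg_points
  have inv1i: "M ` L ` X = X" and inv2i: "L ` M ` X = X" for X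
    using inv1 inv2 by (simp_all add: image_image)
  have sub: "L ` X \<subseteq> L ` U \<longleftrightarrow> X \<subseteq> U" for X U using inv1 by (metis image_mono inv1i)
  have bij: "bij_betw (restrict ((`) L) pg_points) pg_points pg_points"
    by (rule bij_betw_byWitness[where f' = "(`) M"])
      (use pt[OF L inv1 M] pt[OF M inv2 L] inv1i inv2i in auto)
  have lines: "restrict ((`) L) pg_points ` l \<in> pg_lines" if "l \<in> pg_lines" for l
  proof -
    obtain U where U: "l = {P \<in> pg_points. P \<subseteq> U}" "vec.subspace U" "vec.dim U = 2"
      using \<open>l \<in> pg_lines\<close> unfolding pg_lines_def pg_flats_def by blast
    have "inj L" using inv1 by (metis injI)
    then have "vec.dim (L ` U) = 2"
      using vec.dim_image_eq[OF L inj_on_subset] U by (metis subset_UNIV)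
    moreover have "vec.subspace (L ` U)" using vec.linear_subspace_image[OF L U(2)] .
    moreover have "restrict ((`) L) pg_points ` l = {P \<in> pg_points. P \<subseteq> L ` U}"
    proof (intro equalityI subsetI)
      fix X assume "X \<in> restrict ((`) L) pg_points ` l"
      then show "X \<in> {P \<in> pg_points. P \<subseteq> L ` U}" using U(1) pt[OF L inv1 M] by auto
    next
      fix X assume X: "X \<in> {P \<in> pg_points. P \<subseteq> L ` U}"
      then have "M ` X \<in> pg_points" "M ` X \<subseteq> U" using pt[OF M inv2 L] sub[of "M ` X" U] inv2i by auto
      then have "M ` X \<in> l" "restrict ((`) L) pg_points (M ` X) = X" using U(1) inv2i by auto
      then show "X \<in> restrict ((`) L) pg_points ` l" by (metis imageI)
    qed
    ultimately show ?thesis unfolding pg_lines_def pg_flats_def by blast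
  qed
  show ?thesis unfolding pg_collineation_def using bij lines by auto
qed

section \<open>Rigidity\<close>

text \<open>Weaker than being a collineation: neither surjectivity nor a value off the points is
  prescribed, and a line need only go into the span of two image points. In this form the property
  passes to the composite with a linear bijection.\<close>

definition preserves_collinearity :: "(('k::field ^ 'n) set \<Rightarrow> ('k ^ 'n) set) \<Rightarrow> bool" where
  "preserves_collinearity \<kappa> \<longleftrightarrow> \<kappa> ` pg_points \<subseteq> pg_points \<and> inj_on \<kappa> pg_points \<and>
     (\<forall>x y z. x \<noteq> 0 \<longrightarrow> y \<noteq> 0 \<longrightarrow> z \<noteq> 0 \<longrightarrow> z \<in> vec.span {x, y} \<longrightarrow>
       \<kappa> (vec.span {z}) \<subseteq> vec.span (\<kappa> (vec.span {x}) \<union> \<kappa> (vec.span {y})))"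

text \<open>If \<open>x\<close> and \<open>y\<close> give distinct points, their images are distinct
  points of the image line and therefore span it. Otherwise all three points coincide.\<close>

lemma collineation_preserves_collinearity:
  fixes \<kappa> :: "('k::field ^ 'n) set \<Rightarrow> ('k ^ 'n) set"
  assumes \<kappa>: "pg_collineation \<kappa>" shows "preserves_collinearity \<kappa>"
  unfolding preserves_collinearity_def
proof (intro conjI allI impI)
  have inj: "inj_on \<kappa> pg_points" and im: "\<kappa> ` pg_points = pg_points"
    using \<kappa> by (auto simp: pg_collineation_def bij_betw_def)
  then show "\<kappa> ` pg_points \<subseteq> pg_points" "inj_on \<kappa> pg_points" by simp_all
  fix x y z :: "'k ^ 'n" assume nz: "x \<noteq> 0" "y \<noteq> 0" "z \<noteq> 0" and z: "z \<in> vec.span {x, y}"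
  have pts: "vec.span {x} \<in> pg_points" "vec.span {y} \<in> pg_points" "vec.span {z} \<in> pg_points"
    using nz pg_points_iff by blast+
  show "\<kappa> (vec.span {z}) \<subseteq> vec.span (\<kappa> (vec.span {x}) \<union> \<kappa> (vec.span {y}))"
  proof (cases "x \<in> vec.span {y}")
    case True
    then have "vec.span {x, y} = vec.span {y}" by (rule vec.span_redundant)
    then have "vec.span {z} = vec.span {y}" using z span_singleton_cancel[OF nz(3)] by simp
    then show ?thesis using vec.span_superset by (metis Un_subset_iff)
  next
    case False
    let ?U = "vec.span {x, y}"
    have "vec.dim ?U = 2" using False nz(2) by (simp add: vec.dim_insert vec.dim_singleton)
    then have "{P \<in> pg_points. P \<subseteq> ?U} \<in> pg_lines" (is "?l \<in> _")
      unfolding pg_lines_def pg_flats_def using vec.subspace_span by blast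
    then have "\<kappa> ` ?l \<in> pg_lines" using \<kappa> by (simp add: pg_collineation_def)
    then obtain U' where U': "\<kappa> ` ?l = {P \<in> pg_points. P \<subseteq> U'}" "vec.subspace U'" "vec.dim U' = 2"
      unfolding pg_lines_def pg_flats_def by blast
    have "vec.span {x} \<in> ?l" "vec.span {y} \<in> ?l" "vec.span {z} \<in> ?l"
      using pts z by (auto simp: span_singleton_subset vec.span_base)
    then have in_U': "\<kappa> (vec.span {x}) \<subseteq> U'" "\<kappa> (vec.span {y}) \<subseteq> U'" "\<kappa> (vec.span {z}) \<subseteq> U'"
      using U'(1) by blast+
    have ne: "\<kappa> (vec.span {x}) \<noteq> \<kappa> (vec.span {y})"
    proof
      assume "\<kappa> (vec.span {x}) = \<kappa> (vec.span {y})"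
      then have "vec.span {x} = vec.span {y}" using inj_onD[OF inj] pts by blast
      then show False using False by (metis singletonI vec.span_base)
    qed
    have "\<kappa> (vec.span {x}) \<in> pg_points" "\<kappa> (vec.span {y}) \<in> pg_points" using im pts by blast+
    then obtain x' y' where xy': "x' \<noteq> 0" "\<kappa> (vec.span {x}) = vec.span {x'}"
      "y' \<noteq> 0" "\<kappa> (vec.span {y}) = vec.span {y'}" using pg_points_iff by metis
    have "x' \<notin> vec.span {y'}" using ne xy' span_singleton_cancel by metis
    then have "vec.dim (vec.span {x', y'}) = 2"
      using xy' by (simp add: vec.dim_insert vec.dim_singleton)
    moreover have "vec.span {x', y'} \<subseteq> U'"
      using in_U' xy' U'(2) by (intro vec.span_minimal) (auto simp: span_singleton_subset)
    ultimately have "vec.span {x', y'} = U'"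
      using vec.subspace_dim_equal[OF vec.subspace_span U'(2)] U'(3) by simp
    moreover have "vec.span {x', y'} \<subseteq> vec.span (vec.span {x'} \<union> vec.span {y'})"
      by (rule vec.span_mono) (auto intro: vec.span_base)
    ultimately show ?thesis using in_U'(3) xy' by simp
  qed
qed

text \<open>Induction on a linear combination: the point of \<open>c *s t + y\<close> lies on the
  line joining the points of \<open>t\<close> and \<open>y\<close>, apart from degenerate
  cases.\<close>

lemma preserves_span:
  assumes \<kappa>: "preserves_collinearity \<kappa>" and T: "0 \<notin> T" and x: "x \<in> vec.span T" "x \<noteq> 0"
  shows "\<kappa> (vec.span {x}) \<subseteq> vec.span (\<Union>t\<in>T. \<kappa> (vec.span {t}))" (is "_ \<subseteq> ?R")
proof -
  have "x = 0 \<or> \<kappa> (vec.span {x}) \<subseteq> ?R"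
    using x(1)
  proof (induction rule: vec.span_induct_alt)
    case base
    show ?case by simp
  next
    case (step c t y)
    have t: "t \<noteq> 0" "\<kappa> (vec.span {t}) \<subseteq> ?R"
      using step(1) T vec.span_superset[of "\<Union>t\<in>T. \<kappa> (vec.span {t})"] by auto
    consider "c *s t + y = 0" | "c = 0" | "c \<noteq> 0" "y = 0" | "c *s t + y \<noteq> 0" "y \<noteq> 0" by blast
    then show ?case
    proof cases
      case 3
      then show ?thesis using t span_singleton_eqI[of c t] by simp
    next
      case 4
      have "c *s t + y \<in> vec.span {t, y}" by (simp add: vec.span_add vec.span_base vec.span_scale)
      then have "\<kappa> (vec.span {c *s t + y}) \<subseteq> vec.span (\<kappa> (vec.span {t}) \<union> \<kappa> (vec.span {y}))"
        using \<kappa> t(1) 4 unfolding preserves_collinearity_def by blast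
      also have "\<dots> \<subseteq> ?R" using t(2) step 4 by (intro vec.span_minimal) auto
      finally show ?thesis by blast
    qed (use step in simp_all)
  qed
  then show ?thesis using x(2) by blast
qed

text \<open>Equal columns with different indices would be matched in every row, but the matchings of
  rows 0 and 1 have no pair in common.\<close>

lemma pentagon_columns_distinct:
  assumes ne: "(1::'k::field) \<noteq> -1" and l: "l < 6" "m < 6"
    and eq: "\<And>i. i < 5 \<Longrightarrow> pentagon i l = (pentagon i m :: 'k)"
  shows "l = m"
proof (rule ccontr)
  assume "l \<noteq> m"
  then have "l = partner i m" if "i < 5" for i
    using partner_unique[OF ne that l(2,1) _ eq[OF that]] by blast
  from this[of 0] this[of 1] have "partner 0 m = partner 1 m" by simp
  then show False using l(2) unfolding nat_less_6 by (elim insertE emptyE; simp add: partner_def)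
qed

section \<open>Fixed points of a map preserving the normal form\<close>

text \<open>Fixed points spread in stages: to all twelve points, to the lines joining two basis
  points, and then to every point by induction on the number of nonzero coordinates.\<close>

lemma golay_rigidity:
  fixes b :: "nat \<Rightarrow> 'k::field ^ 6"
  assumes k3: "CARD('k) = 3" and F: "frame b \<phi>" and \<kappa>: "preserves_collinearity \<kappa>"
    and inv: "\<kappa> ` golay_points b \<subseteq> golay_points b"
    and fix5: "\<And>i. i < 5 \<Longrightarrow> \<kappa> (vec.span {b i}) = vec.span {b i}"
    and X: "X \<in> pg_points"
  shows "\<kappa> X = X"
proof -
  note ne = gf3_cases(3)[OF k3]
  have \<kappa>_pts: "\<kappa> ` pg_points \<subseteq> pg_points" and \<kappa>_inj: "inj_on \<kappa> pg_points"
    using \<kappa> by (simp_all add: preserves_collinearity_def)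
  note lin = frame_linear[OF F] and dual = frame_dual[OF F] and eqI = frame_eqI[OF F]
  note scale = linear_form_scale[OF lin]
  have pt: "vec.span {x} \<in> pg_points" if "x \<noteq> 0" for x :: "'k ^ 6" using that pg_points_iff by blast
  have inj: "vec.span {x} = vec.span {y}"
    if "\<kappa> (vec.span {x}) = \<kappa> (vec.span {y})" "x \<noteq> 0" "y \<noteq> 0" for x y
    using inj_onD[OF \<kappa>_inj that(1) pt pt] that(2,3) by simp
  have image: "\<exists>y. y \<noteq> 0 \<and> \<kappa> (vec.span {x}) = vec.span {y}" if "x \<noteq> 0" for x
    using \<kappa>_pts pt[OF that] pg_points_iff[of "\<kappa> (vec.span {x})"] by blast
  \<comment> \<open>Vectors are collected instead of points so that spans and linear forms apply
    directly.\<close>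
  define fixed where "fixed = {x. x \<noteq> 0 \<and> \<kappa> (vec.span {x}) = vec.span {x}}"
  have fixed_nz: "0 \<notin> fixed" by (simp add: fixed_def)
  have in_span: "\<kappa> (vec.span {x}) \<subseteq> vec.span T" if "T \<subseteq> fixed" "x \<in> vec.span T" "x \<noteq> 0" for x T
  proof -
    have "0 \<notin> T" using that fixed_nz by blast
    from preserves_span[OF \<kappa> this that(2,3)]
    have "\<kappa> (vec.span {x}) \<subseteq> vec.span (\<Union>t\<in>T. vec.span {t})"
      using that(1) by (simp add: fixed_def subset_iff)
    also have "(\<Union>t\<in>T. vec.span {t}) \<subseteq> vec.span T"
      by (intro UN_least vec.span_mono) simp
    then have "vec.span (\<Union>t\<in>T. vec.span {t}) \<subseteq> vec.span T"
      by (intro vec.span_minimal vec.subspace_span)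
    finally show ?thesis .
  qed
  have vanish: "f y = 0" if "linear_form f" "\<And>t. t \<in> T \<Longrightarrow> f t = 0" "y \<in> vec.span T"
    for f :: "'k ^ 6 \<Rightarrow> 'k" and T y
  proof -
    have "vec.span T \<subseteq> {x. f x = 0}"
      by (rule vec.span_minimal) (use that(2) subspace_kernel[OF that(1)] in auto)
    then show ?thesis using that(3) by blast
  qed
  have mem_self: "x \<in> vec.span {x}" for x :: "'k ^ 6" by (simp add: vec.span_base)
  \<comment> \<open>The image of the point of \<open>x\<close> lies in both spans, which are
    generated by fixed points and meet only in that point.\<close>
  have meet: "x \<in> fixed"
    if T: "T \<subseteq> fixed" "T' \<subseteq> fixed" "x \<noteq> 0" "x \<in> vec.span T" "x \<in> vec.span T'"
      and T_meet: "\<And>y. y \<in> vec.span T \<Longrightarrow> y \<in> vec.span T' \<Longrightarrow> \<exists>c. y = c *s x" for T T' x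
  proof -
    obtain y where y: "y \<noteq> 0" "\<kappa> (vec.span {x}) = vec.span {y}" using image[OF T(3)] by blast
    have "y \<in> vec.span T" "y \<in> vec.span T'"
      using in_span[OF T(1,4,3)] in_span[OF T(2,5,3)] y(2) mem_self by blast+
    then obtain c where "y = c *s x" using T_meet by blast
    then have "vec.span {y} = vec.span {x}"
      using y(1) by (metis span_singleton_eqI vec.scale_zero_left)
    then show ?thesis using y T(3) by (simp add: fixed_def)
  qed
  have fixed_scale: "c *s x \<in> fixed" if "x \<in> fixed" "c \<noteq> 0" for c x
    using that span_singleton_eqI[OF that(2), of x] by (simp add: fixed_def)
  have b_nz: "b i \<noteq> 0" if "i < 6" for i
    using dual[OF that that] linear_form_zero[OF lin[OF that]] by auto
  have b_fixed5: "b i \<in> fixed" if "i < 5" for i using fix5[OF that] b_nz[of i] that by (simp add: fixed_def)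
  define u where "u = (\<Sum>i<5. b i)"
  define w where "w l = b 5 + (\<Sum>i<5. pentagon i l *s b i)" for l
  have u: "\<phi> i u = (if i = 5 then 0 else 1)" if "i < 6" for i
    using frame_coord_hexad[OF F that] by (simp add: u_def)
  have w: "\<phi> i (w l) = (if i = 5 then 1 else pentagon i l)" if "i < 6" for i l
    using frame_coord_pentagon[OF F that] by (simp add: w_def)
  have u_nz: "u \<noteq> 0" using u[of 0] linear_form_zero[OF lin[of 0]] by auto
  have w_nz: "w l \<noteq> 0" for l using w[of 5 l] linear_form_zero[OF lin[of 5]] by auto
  have golay: "(\<exists>i<5. Y = vec.span {b i}) \<or> Y = vec.span {u} \<or> (\<exists>l<6. Y = vec.span {w l})"
    if "Y \<in> golay_points b" for Y
    using that by (auto simp: golay_points_def u_def w_def)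
  have golay_in: "vec.span {u} \<in> golay_points b" "\<And>l. l < 6 \<Longrightarrow> vec.span {w l} \<in> golay_points b"
    by (auto simp: golay_points_def u_def w_def)
  have span_neq: "vec.span {x} \<noteq> vec.span {y}" if "linear_form f" "f y = 0" "f x \<noteq> 0"
    for f :: "'k ^ 6 \<Rightarrow> 'k" and x y
    using vanish[OF that(1), of "{y}" x] that(2,3) mem_self[of x] by auto
  \<comment> \<open>The image stays in the span of the first five basis vectors, which excludes
    every \<open>w l\<close>; injectivity excludes the points \<open>b i\<close>.\<close>
  have u_fixed: "u \<in> fixed"
  proof -
    have "u \<in> vec.span (b ` {..<5})" unfolding u_def by (intro vec.span_sum vec.span_base) auto
    moreover have "b ` {..<5} \<subseteq> fixed" using b_fixed5 by auto
    ultimately have sub: "\<kappa> (vec.span {u}) \<subseteq> vec.span (b ` {..<5})" using in_span u_nz by blast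
    have no_w: "\<kappa> (vec.span {u}) \<noteq> vec.span {w l}" for l
    proof
      assume "\<kappa> (vec.span {u}) = vec.span {w l}"
      then have "w l \<in> vec.span (b ` {..<5})" using sub mem_self by blast
      then have "\<phi> 5 (w l) = 0" by (rule vanish[OF lin[of 5], rotated -1]) (auto simp: dual)
      then show False using w[of 5] by simp
    qed
    have no_b: "\<kappa> (vec.span {u}) \<noteq> vec.span {b i}" if i: "i < 5" for i
    proof
      assume "\<kappa> (vec.span {u}) = vec.span {b i}"
      then have eq: "vec.span {u} = vec.span {b i}" using inj fix5[OF i] u_nz b_nz[of i] i by auto
      define j :: nat where "j = (if i = 0 then 1 else 0)"
      have "j < 6" "j \<noteq> 5" "j \<noteq> i" by (auto simp: j_def)
      then show False using span_neq[OF lin[of j], of "b i" u] eq u[of j] dual[of j i] i by auto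
    qed
    have "\<kappa> (vec.span {u}) \<in> golay_points b" using inv golay_in(1) by blast
    then have "\<kappa> (vec.span {u}) = vec.span {u}" using golay no_w no_b by blast
    then show ?thesis using u_nz by (simp add: fixed_def)
  qed
  have "\<exists>m<6. \<kappa> (vec.span {w l}) = vec.span {w m}" if l: "l < 6" for l
  proof -
    have "\<kappa> (vec.span {w l}) \<noteq> vec.span {v}" if v: "v \<in> fixed" "\<phi> 5 v = 0" for v
    proof
      assume "\<kappa> (vec.span {w l}) = vec.span {v}"
      then have "vec.span {w l} = vec.span {v}" using inj v(1) w_nz by (auto simp: fixed_def)
      then show False using span_neq[OF lin[of 5], of v "w l"] v(2) w[of 5 l] by simp
    qed
    then have "\<kappa> (vec.span {w l}) \<noteq> vec.span {u}" "\<And>i. i < 5 \<Longrightarrow> \<kappa> (vec.span {w l}) \<noteq> vec.span {b i}"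
      using u_fixed u[of 5] b_fixed5 dual[of 5] by auto
    moreover have "\<kappa> (vec.span {w l}) \<in> golay_points b" using inv golay_in(2)[OF l] by blast
    ultimately show ?thesis using golay by blast
  qed
  then obtain \<tau> where \<tau>: "\<And>l. l < 6 \<Longrightarrow> \<tau> l < 6 \<and> \<kappa> (vec.span {w l}) = vec.span {w (\<tau> l)}" by metis
  have w_inj: "l = m" if eq: "vec.span {w l} = vec.span {w m}" and lm: "l < 6" "m < 6" for l m
  proof -
    have "w l \<in> vec.span {w m}" using eq mem_self by blast
    then obtain c where c: "w l = c *s w m" by (auto simp: vec.span_singleton)
    then have "\<phi> 5 (w l) = c * \<phi> 5 (w m)" by (simp add: scale)
    then have "c = 1" using w[of 5] by simp
    then have "w l = w m" using c by simp
    then have "pentagon i l = (pentagon i m :: 'k)" if "i < 5" for i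
      using w[of i l] w[of i m] that by simp
    then show ?thesis using pentagon_columns_distinct[OF ne lm] by blast
  qed
  have comm: "\<tau> (partner i l) = partner i (\<tau> l)" if i: "i < 5" and l: "l < 6" for i l
  proof -
    let ?m = "partner i l" and ?B = "b ` ({..<5} - {i})"
    have m: "?m < 6" "?m \<noteq> l" using partner_less[OF i l] partner_neq[OF i l] by auto
    \<comment> \<open>The columns \<open>l\<close> and \<open>?m\<close> of \<open>pentagon\<close> agree in row \<open>i\<close>, so \<open>b i\<close> does not occur in the difference;
      this incidence with the span of the other four points survives under \<open>\<kappa>\<close>.\<close>
    have "w ?m - 1 *s w l = (\<Sum>j<5. (pentagon j ?m - pentagon j l) *s b j)"
      by (simp add: w_def vec.scale_left_diff_distrib sum_subtractf)
    also have "\<dots> \<in> vec.span ?B"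
    proof (rule vec.span_sum)
      fix j :: nat assume "j \<in> {..<5}"
      then show "(pentagon j ?m - pentagon j l) *s b j \<in> vec.span ?B"
        by (cases "j = i") (auto simp: pentagon_partner[OF i l] vec.span_zero intro!: vec.span_scale[OF vec.span_base])
    qed
    finally have "w ?m \<in> vec.span (insert (w l) ?B)" using vec.span_breakdown_eq by blast
    moreover have "0 \<notin> insert (w l) ?B" using w_nz b_nz by force
    ultimately have "\<kappa> (vec.span {w ?m}) \<subseteq> vec.span (\<Union>t\<in>insert (w l) ?B. \<kappa> (vec.span {t}))"
      using preserves_span[OF \<kappa>] w_nz by blast
    moreover have "w (\<tau> ?m) \<in> \<kappa> (vec.span {w ?m})" using \<tau>[OF m(1)] mem_self by simp
    ultimately have mem: "w (\<tau> ?m) \<in> vec.span (\<Union>t\<in>insert (w l) ?B. \<kappa> (vec.span {t}))" by blast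
    \<comment> \<open>This form vanishes at \<open>w (\<tau> l)\<close> and at all
      \<open>b j\<close> with \<open>j < 5\<close> and \<open>j \<noteq> i\<close>, hence at
      \<open>w (\<tau> ?m)\<close>. There it compares two entries of row \<open>i\<close>.\<close>
    define \<psi> where "\<psi> x = \<phi> i x - pentagon i (\<tau> l) * \<phi> 5 x" for x
    have lin\<psi>: "linear_form \<psi>"
      using lin[of i] lin[of 5] i by (auto simp: linear_form_iff \<psi>_def algebra_simps)
    have "\<psi> (w (\<tau> ?m)) = 0"
    proof (rule vanish[OF lin\<psi> _ mem])
      fix t assume "t \<in> (\<Union>t\<in>insert (w l) ?B. \<kappa> (vec.span {t}))"
      then consider "t \<in> vec.span {w (\<tau> l)}" | j where "j < 5" "j \<noteq> i" "t \<in> vec.span {b j}"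
        using \<tau>[OF l] fix5 by auto
      then show "\<psi> t = 0"
      proof cases
        case 1
        show ?thesis by (rule vanish[OF lin\<psi> _ 1]) (use i w[of i] w[of 5] in \<open>auto simp: \<psi>_def\<close>)
      next
        case 2
        show ?thesis by (rule vanish[OF lin\<psi> _ 2(3)]) (use i 2 dual[of i j] dual[of 5 j] in \<open>auto simp: \<psi>_def\<close>)
      qed
    qed
    then have eq: "pentagon i (\<tau> ?m) = (pentagon i (\<tau> l) :: 'k)"
      using w[of i] w[of 5] i by (simp add: \<psi>_def)
    have "\<tau> ?m \<noteq> \<tau> l"
    proof
      assume "\<tau> ?m = \<tau> l"
      then have "\<kappa> (vec.span {w ?m}) = \<kappa> (vec.span {w l})" using \<tau>[OF l] \<tau>[OF m(1)] by simp
      then have "vec.span {w ?m} = vec.span {w l}" using inj w_nz by blast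
      then show False using w_inj m l by blast
    qed
    then show ?thesis using partner_unique[OF ne i _ _ _ eq] \<tau>[OF l] \<tau>[OF m(1)] by blast
  qed
  have "\<tau> l = l" if "l < 6" for l
    by (rule centralizer_partners_trivial[OF _ comm that]) (use \<tau> in blast)
  then have w_fixed: "w l \<in> fixed" if "l < 6" for l using \<tau>[OF that] that w_nz by (simp add: fixed_def)
  \<comment> \<open>Column 5 of \<open>pentagon\<close> is zero, so the sixth basis point is among
    the points already fixed.\<close>
  have "w 5 = b 5" by (rule eqI) (use w dual[of _ 5] in \<open>auto simp: pentagon_def\<close>)
  then have b_fixed: "b i \<in> fixed" if "i < 6" for i
    using w_fixed[of 5] b_fixed5[of i] that by (cases "i = 5") auto
  \<comment> \<open>This is where the line through \<open>b i\<close> and \<open>b j\<close> meets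
    the span of \<open>v\<close> and the other four basis vectors.\<close>
  have pair: "\<phi> i v *s b i + \<phi> j v *s b j \<in> fixed"
    if v: "v \<in> fixed" and ij: "i < 6" "j < 6" "i \<noteq> j" "\<phi> i v \<noteq> 0" for v i j
  proof (rule meet[of "{b i, b j}" "insert v (b ` ({..<6} - {i, j}))"])
    let ?x = "\<phi> i v *s b i + \<phi> j v *s b j" and ?T = "b ` ({..<6} - {i, j})"
    have xc: "\<phi> k ?x = (if k = i \<or> k = j then \<phi> k v else 0)" if "k < 6" for k
      using lin[OF that] dual[OF that ij(1)] dual[OF that ij(2)] ij(3) by (auto simp: linear_form_iff)
    show "{b i, b j} \<subseteq> fixed" "insert v ?T \<subseteq> fixed" using b_fixed ij v by auto
    show "?x \<noteq> 0" using xc[OF ij(1)] ij(4) linear_form_zero[OF lin[OF ij(1)]] by auto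
    show "?x \<in> vec.span {b i, b j}" by (intro vec.span_add vec.span_scale vec.span_base) auto
    have "{..<6} = insert i (insert j ({..<6} - {i, j}))" using ij by auto
    then have "v = \<phi> i v *s b i + (\<phi> j v *s b j + (\<Sum>k\<in>{..<6} - {i, j}. \<phi> k v *s b k))"
      using frame_expansion[OF F, of v] ij(3)
      by (metis (no_types, lifting) Diff_iff finite_Diff finite_lessThan insertCI insertE finite_insert sum.insert)
    then have "?x = v - (\<Sum>k\<in>{..<6} - {i, j}. \<phi> k v *s b k)" by (simp add: algebra_simps)
    also have "\<dots> \<in> vec.span (insert v ?T)"
      by (intro vec.span_diff vec.span_sum vec.span_scale vec.span_base) auto
    finally show "?x \<in> vec.span (insert v ?T)" .
    fix y assume y: "y \<in> vec.span {b i, b j}" "y \<in> vec.span (insert v ?T)"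
    have y0: "\<phi> k y = 0" if "k < 6" "k \<noteq> i" "k \<noteq> j" for k
      by (rule vanish[OF lin[OF that(1)] _ y(1)]) (use dual[OF that(1)] that ij in auto)
    define \<psi> where "\<psi> z = \<phi> j v * \<phi> i z - \<phi> i v * \<phi> j z" for z
    have "linear_form \<psi>"
      using lin[OF ij(1)] lin[OF ij(2)] by (auto simp: linear_form_iff \<psi>_def algebra_simps)
    then have "\<psi> y = 0"
      by (rule vanish[OF _ _ y(2)]) (use dual[OF ij(1)] dual[OF ij(2)] in \<open>auto simp: \<psi>_def split: if_splits\<close>)
    then have eq: "\<phi> j v * \<phi> i y = \<phi> i v * \<phi> j y" by (simp add: \<psi>_def)
    have "y = (\<phi> i y / \<phi> i v) *s ?x"
    proof (rule eqI)
      fix k :: nat assume k: "k < 6"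
      show "\<phi> k y = \<phi> k ((\<phi> i y / \<phi> i v) *s ?x)"
        unfolding scale[OF k] xc[OF k] using y0[OF k] eq ij(4) by (auto simp: field_simps)
    qed
    then show "\<exists>c. y = c *s ?x" by blast
  qed
  have two_terms: "x \<in> fixed"
    if ij: "i < 6" "j < 6" "i \<noteq> j" and x: "x = \<alpha> *s b i + \<beta> *s b j" "\<alpha> \<noteq> 0" "\<beta> \<noteq> 0" for i j \<alpha> \<beta> x
  proof -
    have "\<exists>v\<in>fixed. \<phi> i v \<noteq> 0 \<and> \<phi> j v \<noteq> 0"
    proof (cases "i = 5 \<or> j = 5")
      case False
      then show ?thesis using u_fixed u ij by (intro bexI[of _ u]) auto
    next
      case True
      \<comment> \<open>The vector \<open>u\<close> has no component along \<open>b 5\<close>, so a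
        pair containing 5 needs a \<open>w k\<close>. Its only zero coordinate is \<open>k\<close>,
        chosen different from \<open>i\<close> and \<open>j\<close>.\<close>
      define k :: nat where "k = (if i = 0 \<or> j = 0 then 1 else 0)"
      have k: "k < 5" "k \<noteq> i" "k \<noteq> j" using True by (auto simp: k_def)
      have "pentagon n k \<noteq> (0::'k)" if "n \<noteq> k" for n using that k(1) by (simp add: pentagon_def)
      then show ?thesis using w_fixed[of k] w ij k by (intro bexI[of _ "w k"]) auto
    qed
    then obtain v where v: "v \<in> fixed" "\<phi> i v \<noteq> 0" "\<phi> j v \<noteq> 0" by blast
    define s where "s = \<phi> j v / \<phi> i v"
    have s: "s \<noteq> 0" using v by (simp add: s_def)
    have "(1 / \<phi> i v) *s (\<phi> i v *s b i + \<phi> j v *s b j) \<in> fixed"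
      using fixed_scale[OF pair[OF v(1) ij v(2)], of "1 / \<phi> i v"] v(2) by simp
    then have s_fixed: "b i + s *s b j \<in> fixed" using v(2) by (simp add: s_def vec.scale_right_distrib)
    have coord: "\<phi> k (a *s b i + c *s b j) = (if k = i then a else if k = j then c else 0)"
      if "k < 6" for k a c
      using lin[OF that] dual[OF that ij(1)] dual[OF that ij(2)] ij(3) by (auto simp: linear_form_iff)
    have pm: "t = 1 \<or> t = -1" if "t \<noteq> 0" for t :: 'k using gf3_cases(1)[OF k3, of t] that by blast
    \<comment> \<open>The fourth point of a line with three fixed points.\<close>
    have other: "b i + (-s) *s b j \<in> fixed"
    proof -
      let ?z = "b i + (-s) *s b j"
      have cz: "\<phi> k ?z = (if k = i then 1 else if k = j then -s else 0)" if "k < 6" for k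
        using coord[OF that, of 1 "-s"] by simp
      have cs: "\<phi> k (b i + s *s b j) = (if k = i then 1 else if k = j then s else 0)" if "k < 6" for k
        using coord[OF that, of 1 s] by simp
      have z_nz: "?z \<noteq> 0" using cz[OF ij(1)] linear_form_zero[OF lin[OF ij(1)]] by auto
      obtain y where y: "y \<noteq> 0" "\<kappa> (vec.span {?z}) = vec.span {y}" using image[OF z_nz] by blast
      have "?z \<in> vec.span {b i, b j}" by (intro vec.span_add vec.span_scale vec.span_base) auto
      moreover have "{b i, b j} \<subseteq> fixed" using b_fixed ij by auto
      ultimately have y_span: "y \<in> vec.span {b i, b j}" using in_span z_nz y(2) mem_self by blast
      have y0: "\<phi> k y = 0" if "k < 6" "k \<noteq> i" "k \<noteq> j" for k
        by (rule vanish[OF lin[OF that(1)] _ y_span]) (use dual[OF that(1)] that ij in auto)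
      have avoid: "\<not> (\<exists>c. y = c *s v')" if "v' \<in> fixed" "vec.span {?z} \<noteq> vec.span {v'}" for v'
      proof
        assume "\<exists>c. y = c *s v'"
        then have "vec.span {y} = vec.span {v'}" using y(1) by (metis span_singleton_eqI vec.scale_zero_left)
        then have "\<kappa> (vec.span {?z}) = \<kappa> (vec.span {v'})" using y(2) that(1) by (simp add: fixed_def)
        then show False using inj z_nz that by (auto simp: fixed_def)
      qed
      have yi: "\<phi> i y \<noteq> 0"
      proof
        assume "\<phi> i y = 0"
        then have "y = \<phi> j y *s b j" by (intro eqI) (use y0 scale dual ij in auto)
        moreover have "vec.span {?z} \<noteq> vec.span {b j}"
          by (rule span_neq[OF lin[OF ij(1)]]) (use cz ij dual in auto)
        ultimately show False using avoid[OF b_fixed[OF ij(2)]] by blast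
      qed
      have yj: "\<phi> j y \<noteq> 0"
      proof
        assume "\<phi> j y = 0"
        then have "y = \<phi> i y *s b i" by (intro eqI) (use y0 scale dual ij in auto)
        moreover have "vec.span {?z} \<noteq> vec.span {b i}"
          by (rule span_neq[OF lin[OF ij(2)]]) (use cz ij dual s in auto)
        ultimately show False using avoid[OF b_fixed[OF ij(1)]] by blast
      qed
      have "\<phi> j y \<noteq> s * \<phi> i y"
      proof
        assume eq: "\<phi> j y = s * \<phi> i y"
        have "y = \<phi> i y *s (b i + s *s b j)" by (rule eqI) (use y0 scale cs eq ij in auto)
        moreover have "vec.span {?z} \<noteq> vec.span {b i + s *s b j}"
        proof (rule span_neq)
          show "linear_form (\<lambda>x. \<phi> j x - s * \<phi> i x)"
            using lin[OF ij(1)] lin[OF ij(2)] by (auto simp: linear_form_iff algebra_simps)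
          show "\<phi> j (b i + s *s b j) - s * \<phi> i (b i + s *s b j) = 0" using cs ij by auto
          have "-s - s \<noteq> 0" using pm[OF s] by (auto simp: gf3_numeral[OF k3])
          then show "\<phi> j ?z - s * \<phi> i ?z \<noteq> 0" using cz ij by auto
        qed
        ultimately show False using avoid[OF s_fixed] by blast
      qed
      then have "\<phi> j y = (-s) * \<phi> i y" using pm[OF yi] pm[OF yj] pm[OF s] by auto
      then have "y = \<phi> i y *s ?z" by (intro eqI) (use y0 scale cz ij in auto)
      then have "vec.span {y} = vec.span {?z}" using y(1) by (metis span_singleton_eqI vec.scale_zero_left)
      then show ?thesis using y(2) z_nz by (simp add: fixed_def)
    qed
    have "\<beta> = \<alpha> * s \<or> \<beta> = \<alpha> * -s" using pm[OF x(2)] pm[OF x(3)] pm[OF s] by auto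
    then have "x = \<alpha> *s (b i + s *s b j) \<or> x = \<alpha> *s (b i + (-s) *s b j)"
      using x(1) by (auto simp: vec.scale_right_distrib vec.scale_right_diff_distrib)
    then show ?thesis using fixed_scale s_fixed other x(2) by auto
  qed
  \<comment> \<open>With three nonzero coordinates \<open>i\<close>, \<open>j\<close>,
    \<open>k\<close>, the point of \<open>x\<close> is the intersection of the line through
    \<open>b i\<close> and \<open>r i\<close> with the line through \<open>b j\<close> and
    \<open>r j\<close>. Here \<open>r n\<close> is \<open>x\<close> without coordinate
    \<open>n\<close>, fixed by induction and nonzero because of coordinate \<open>k\<close>.\<close>
  have all_fixed: "x \<in> fixed" if "x \<noteq> 0" for x
    using that
  proof (induction "card {i \<in> {..<6}. \<phi> i x \<noteq> 0}" arbitrary: x rule: less_induct)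
    case less
    let ?S = "{i \<in> {..<6::nat}. \<phi> i x \<noteq> 0}"
    obtain i where i: "i < 6" "\<phi> i x \<noteq> 0"
      using eqI[of x 0] linear_form_zero[OF lin] less.prems by auto
    show ?case
    proof (cases "\<exists>j k. j < 6 \<and> k < 6 \<and> j \<noteq> i \<and> k \<noteq> i \<and> j \<noteq> k \<and> \<phi> j x \<noteq> 0 \<and> \<phi> k x \<noteq> 0")
      case True
      then obtain j k where jk: "j < 6" "k < 6" "j \<noteq> i" "k \<noteq> i" "j \<noteq> k" "\<phi> j x \<noteq> 0" "\<phi> k x \<noteq> 0" by blast
      define r where "r n = x - \<phi> n x *s b n" for n
      have rc: "\<phi> m (r n) = (if m = n then 0 else \<phi> m x)" if "m < 6" "n < 6" for m n
        using lin[OF that(1)] dual[OF that] by (simp add: r_def linear_form_diff[OF lin[OF that(1)]] scale[OF that(1)])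
      have rf: "r n \<in> fixed" if n: "n < 6" "\<phi> n x \<noteq> 0" "n \<noteq> k" for n
      proof (rule less.hyps)
        have "{m \<in> {..<6}. \<phi> m (r n) \<noteq> 0} = ?S - {n}"
          using rc n(1) by (auto split: if_splits)
        moreover have "n \<in> ?S" using n by simp
        ultimately have "{m \<in> {..<6}. \<phi> m (r n) \<noteq> 0} \<subset> ?S" by blast
        then show "card {m \<in> {..<6}. \<phi> m (r n) \<noteq> 0} < card ?S" by (intro psubset_card_mono) auto
        show "r n \<noteq> 0" using rc[OF jk(2) n(1)] n(3) jk(7) linear_form_zero[OF lin[OF jk(2)]] by auto
      qed
      have x_in: "x \<in> vec.span {b n, r n}" for n
      proof -
        have "x = \<phi> n x *s b n + r n" by (simp add: r_def)
        also have "\<dots> \<in> vec.span {b n, r n}" by (intro vec.span_add vec.span_scale vec.span_base) auto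
        finally show ?thesis .
      qed
      show ?thesis
      proof (rule meet[of "{b i, r i}" "{b j, r j}"])
        show "{b i, r i} \<subseteq> fixed" "{b j, r j} \<subseteq> fixed" using b_fixed rf i jk by auto
        show "x \<noteq> 0" by fact
        show "x \<in> vec.span {b i, r i}" "x \<in> vec.span {b j, r j}" by (rule x_in)+
        fix y assume y: "y \<in> vec.span {b i, r i}" "y \<in> vec.span {b j, r j}"
        \<comment> \<open>On the line through \<open>b n\<close> and \<open>r n\<close> the
          coordinates other than \<open>n\<close> are proportional to those of \<open>x\<close>. The
          two lines omit different coordinates, so together they cover all.\<close>
        have ratio: "\<phi> k x * \<phi> m y = \<phi> m x * \<phi> k y"
          if "y \<in> vec.span {b n, r n}" "n < 6" "m < 6" "m \<noteq> n" "n \<noteq> k" for m n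
        proof -
          have "linear_form (\<lambda>z. \<phi> k x * \<phi> m z - \<phi> m x * \<phi> k z)"
            using lin[OF jk(2)] lin[OF that(3)] by (auto simp: linear_form_iff algebra_simps)
          then have "\<phi> k x * \<phi> m y - \<phi> m x * \<phi> k y = 0"
            by (rule vanish[OF _ _ that(1)])
              (use that jk(2) rc dual in \<open>auto split: if_splits\<close>)
          then show ?thesis by simp
        qed
        have "y = (\<phi> k y / \<phi> k x) *s x"
        proof (rule eqI)
          fix m :: nat assume m: "m < 6"
          have "\<phi> k x * \<phi> m y = \<phi> m x * \<phi> k y"
            using ratio[OF y(1) i(1) m] ratio[OF y(2) jk(1) m] jk by (cases "m = i") auto
          then show "\<phi> m y = \<phi> m ((\<phi> k y / \<phi> k x) *s x)"
            unfolding scale[OF m] using jk(7) by (simp add: field_simps)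
        qed
        then show "\<exists>c. y = c *s x" by blast
      qed
    next
      case False
      show ?thesis
      proof (cases "\<exists>j. j < 6 \<and> j \<noteq> i \<and> \<phi> j x \<noteq> 0")
        case True
        then obtain j where j: "j < 6" "j \<noteq> i" "\<phi> j x \<noteq> 0" by blast
        have "\<phi> m x = 0" if "m < 6" "m \<noteq> i" "m \<noteq> j" for m using False j that by blast
        then have "x = \<phi> i x *s b i + \<phi> j x *s b j"
          by (intro eqI) (use lin dual i j in \<open>auto simp: linear_form_iff\<close>)
        then show ?thesis using two_terms[OF i(1) j(1) j(2)[symmetric]] i j by blast
      next
        case False
        then have "x = \<phi> i x *s b i" by (intro eqI) (use scale dual i in auto)
        then show ?thesis using fixed_scale[OF b_fixed[OF i(1)] i(2)] by simp
      qed
    qed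
  qed
  obtain x where "x \<noteq> 0" "X = vec.span {x}" using X pg_points_iff by blast
  then show ?thesis using all_fixed[of x] by (simp add: fixed_def)
qed

section \<open>Existence and uniqueness of the collineation\<close>

theorem theorem3:
  fixes K K' :: "('k::field ^ 6) set set"
    and P P' :: "nat \<Rightarrow> ('k ^ 6) set"
  assumes "CARD('k) = 3"
    and "K \<subseteq> pg_points" and "K' \<subseteq> pg_points"
    and "card K = 12" and "card K' = 12"
    and "\<forall>H \<in> pg_hyperplanes. card (H \<inter> K) \<in> {0, 3, 6}"
    and "\<forall>H \<in> pg_hyperplanes. card (H \<inter> K') \<in> {0, 3, 6}"
    and "\<forall>i \<in> {0..4}. P i \<in> K" and "inj_on P {0..4}"
    and "\<forall>i \<in> {0..4}. P' i \<in> K'" and "inj_on P' {0..4}"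
  shows "\<exists>!\<kappa>. pg_collineation \<kappa> \<and> \<kappa> ` K = K' \<and> (\<forall>i \<in> {0..4}. \<kappa> (P i) = P' i)"
proof -
  have P5: "P i \<in> K" "P' i \<in> K'" if "i < 5" for i using assms(8,10) that by auto
  have "{..<5} = {0..4::nat}" by auto
  then have inj5: "inj_on P {..<5}" "inj_on P' {..<5}" using assms(9,11) by simp_all
  obtain b \<phi> where F: "frame b \<phi>" and Pb: "\<forall>i<5. P i = vec.span {b i}" and K: "K = golay_points b"
    by (rule golay_normal_form[OF assms(1,2,4,6) P5(1) inj5(1)])
  obtain b' \<phi>' where F': "frame b' \<phi>'" and Pb': "\<forall>i<5. P' i = vec.span {b' i}"
    and K': "K' = golay_points b'"
    by (rule golay_normal_form[OF assms(1,3,5,7) P5(2) inj5(2)])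
  obtain L M where L: "Vector_Spaces.linear (*s) (*s) L" and M: "Vector_Spaces.linear (*s) (*s) M"
    and inv: "\<forall>x. M (L x) = x" "\<forall>x. L (M x) = x" and Lb: "\<forall>i<6. L (b i) = b' i"
    and Mb: "\<forall>i<6. M (b' i) = b i"
    by (rule frame_map[OF F F'])
  have LM: "L ` M ` X = X" for X using inv(2) by (simp add: image_image)
  \<comment> \<open>The restriction supplies the value \<open>undefined\<close> off the points, as
    \<open>pg_collineation\<close> demands.\<close>
  define \<kappa>\<^sub>0 where "\<kappa>\<^sub>0 = restrict ((`) L) pg_points"
  show ?thesis
  proof (rule ex1I[of _ \<kappa>\<^sub>0])
    have "\<kappa>\<^sub>0 ` K = (`) L ` K" unfolding \<kappa>\<^sub>0_def using assms(2) by (intro image_cong) auto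
    then have "\<kappa>\<^sub>0 ` K = K'" unfolding K K' golay_points_image[OF L Lb] .
    moreover have "\<kappa>\<^sub>0 (P i) = P' i" if "i \<in> {0..4}" for i
    proof -
      have i: "i < 5" using that by simp
      then have "\<kappa>\<^sub>0 (P i) = L ` P i" using P5(1) assms(2) unfolding \<kappa>\<^sub>0_def by auto
      then show ?thesis using i Pb Pb' Lb linear_image_point[OF L, of "b i"] by simp
    qed
    ultimately show "pg_collineation \<kappa>\<^sub>0 \<and> \<kappa>\<^sub>0 ` K = K' \<and> (\<forall>i\<in>{0..4}. \<kappa>\<^sub>0 (P i) = P' i)"
      using linear_collineation[OF L M inv] unfolding \<kappa>\<^sub>0_def by blast
  next
    fix \<kappa> assume \<kappa>: "pg_collineation \<kappa> \<and> \<kappa> ` K = K' \<and> (\<forall>i\<in>{0..4}. \<kappa> (P i) = P' i)"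
    then have "preserves_collinearity \<kappa>" using collineation_preserves_collinearity by blast
    then have pts: "\<kappa> ` pg_points \<subseteq> pg_points" and inj: "inj_on \<kappa> pg_points"
      and pres: "\<And>x y z. x \<noteq> 0 \<Longrightarrow> y \<noteq> 0 \<Longrightarrow> z \<noteq> 0 \<Longrightarrow> z \<in> vec.span {x, y} \<Longrightarrow>
        \<kappa> (vec.span {z}) \<subseteq> vec.span (\<kappa> (vec.span {x}) \<union> \<kappa> (vec.span {y}))"
      unfolding preserves_collinearity_def by simp_all
    \<comment> \<open>Followed by the inverse of \<open>L\<close>, any competitor preserves
      \<open>K\<close> and fixes the five points, so \<open>golay_rigidity\<close> makes it the
      identity on points.\<close>
    let ?\<mu> = "\<lambda>X. M ` \<kappa> X"
    have "inj M" using inv(2) by (metis injI)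
    have "preserves_collinearity ?\<mu>"
      unfolding preserves_collinearity_def
    proof (intro conjI allI impI)
      show "?\<mu> ` pg_points \<subseteq> pg_points"
        using linear_image_pg_points[OF M inv(2) L] pts by blast
      show "inj_on ?\<mu> pg_points"
        using inj \<open>inj M\<close> by (simp add: inj_on_def inj_image_eq_iff)
      fix x y z :: "'k ^ 6"
      assume "x \<noteq> 0" "y \<noteq> 0" "z \<noteq> 0" "z \<in> vec.span {x, y}"
      then have "\<kappa> (vec.span {z}) \<subseteq> vec.span (\<kappa> (vec.span {x}) \<union> \<kappa> (vec.span {y}))"
        by (rule pres)
      then have "?\<mu> (vec.span {z}) \<subseteq> M ` vec.span (\<kappa> (vec.span {x}) \<union> \<kappa> (vec.span {y}))"
        by (rule image_mono)
      then show "?\<mu> (vec.span {z}) \<subseteq> vec.span (?\<mu> (vec.span {x}) \<union> ?\<mu> (vec.span {y}))"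
        unfolding vec.linear_span_image[OF M, symmetric] image_Un .
    qed
    moreover have "?\<mu> ` golay_points b \<subseteq> golay_points b"
    proof -
      have "?\<mu> ` golay_points b = (`) M ` \<kappa> ` K" unfolding K by (simp add: image_image)
      also have "\<dots> = (`) M ` golay_points b'" using \<kappa> K' by simp
      also have "\<dots> = golay_points b" by (rule golay_points_image[OF M Mb])
      finally show ?thesis by simp
    qed
    moreover have "?\<mu> (vec.span {b i}) = vec.span {b i}" if i: "i < 5" for i
    proof -
      have "\<kappa> (vec.span {b i}) = vec.span {b' i}" using \<kappa> Pb Pb' i by auto
      then show ?thesis using linear_image_point[OF M, of "b' i"] Mb i by simp
    qed
    ultimately have fixed: "?\<mu> X = X" if "X \<in> pg_points" for X
      using golay_rigidity[OF assms(1) F _ _ _ that, of ?\<mu>] by blast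
    show "\<kappa> = \<kappa>\<^sub>0"
    proof (rule extensionalityI[of _ pg_points])
      show "\<kappa> \<in> extensional pg_points" using \<kappa> by (simp add: pg_collineation_def)
      show "\<kappa>\<^sub>0 \<in> extensional pg_points" by (simp add: \<kappa>\<^sub>0_def)
      fix X :: "('k ^ 6) set" assume X: "X \<in> pg_points"
      have "\<kappa> X = L ` M ` \<kappa> X" by (simp add: LM)
      also have "\<dots> = L ` X" using fixed[OF X] by simp
      finally show "\<kappa> X = \<kappa>\<^sub>0 X" using X by (simp add: \<kappa>\<^sub>0_def)
    qed
  qed
qed

end
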